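(* Let $\mathcal{A}$ be a compact Hausdorff abelian group and let $\varrho$ be a substitution of constant length $L$ on $\mathcal{A}$ such that each column $\theta\mapsto\varrho(\theta)_j$, $0\le j\le L-1$, is either a group translation or constant, with at least one constant column, and such that one of the columns is a group translation with dense orbit in $\mathcal{A}$. Then $\varrho$ is primitive, and $(X_\varrho,\sigma)$ is strictly ergodic (minimal and uniquely ergodic) with pure point dynamical spectrum.
   Context: An alphabet $\mathcal{A}$ is a compact Hausdorff space; $\mathcal{A}^+=\bigsqcup_{n\ge1}\mathcal{A}^n$ is the space of finite non-empty words. A substitution is a continuous map $\varrho\colon\mathcal{A}\to\mathcal{A}^+$, extended to words by concatenation; it is always assumed that $|\varrho(a)|\ge 2$ for some $a$. It has constant length $L$ if $\varrho(\mathcal{A})\subset\mathcal{A}^L$ (so $L\ge2$); its columns are the maps $\varrho_j(a)=(\varrho(a))_j$, $0\le j\le L-1$. A column is a group translation if $\varrho_j(a)=\beta_j a$ for some $\beta_j\in\mathcal{A}$, and constant if $\varrho_j(a)=\beta_j$ for all $a$. $\varrho$ is primitive if for every non-empty open $U\subset\mathcal{A}$ there is $p\ge0$ such that for all $a\in\mathcal{A}$ some letter of $\varrho^p(a)$ lies in $U$. $\mathcal{L}^n(\varrho)$ is the closure in $\mathcal{A}^n$ of the set of length-$n$ words that occur as subwords of some $\varrho^k(a)$, $a\in\mathcal{A}$, $k\ge1$. The subshift is $X_\varrho=\{w\in\mathcal{A}^{\mathbb{Z}} : w_{[i,j]}\in\mathcal{L}^{j-i+1}(\varrho)\text{ for all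 } i\le j\}$, with left shift $\sigma(w)_n=w_{n+1}$. Pure point dynamical spectrum means that, for the unique invariant probability measure $\mu$, the Koopman operator $Uf=f\circ\sigma$ on $L^2(X_\varrho,\mu)$ has an orthonormal basis of eigenfunctions (equivalently, all spectral measures are pure point). *)

theory Defs
  imports "HOL-Probability.Probability" "HOL-Library.Sublist"
begin

section \<open>Words and substitutions\<close>

text \<open>
  Words over the alphabet \<^typ>\<open>'a\<close> are lists. The set of words of length \<open>n\<close> carries the
  product topology of \<open>n\<close> copies of the alphabet; since the library has product topologies only
  on spaces of functions, it is transported along the bijection sending a word to the
  extensional function on \<open>{..<n}\<close> listing its letters. The space of finite non-empty words is the
  topological disjoint union of these spaces.
\<close>

definition words_of_length :: "nat \<Rightarrow> 'a::topological_space list topology" where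
  "words_of_length n =
     pullback_topology {w. length w = n} (\<lambda>w. \<lambda>i\<in>{..<n}. w ! i)
       (product_topology (\<lambda>_. euclidean) {..<n})"

definition nonempty_words :: "'a::topological_space list topology" where
  "nonempty_words =
     pullback_topology {w. w \<noteq> []} (\<lambda>w. (length w, w)) (sum_topology words_of_length {1..})"

definition substitution :: "('a::topological_space \<Rightarrow> 'a list) \<Rightarrow> bool" where
  "substitution \<rho> \<longleftrightarrow>
     continuous_map euclidean nonempty_words \<rho> \<and> (\<exists>a. length (\<rho> a) \<ge> 2)"

definition constant_length :: "('a \<Rightarrow> 'a list) \<Rightarrow> nat \<Rightarrow> bool" where
  "constant_length \<rho> L \<longleftrightarrow> (\<forall>a. length (\<rho> a) = L)"

definition subst_column :: "('a \<Rightarrow> 'a list) \<Rightarrow> nat \<Rightarrow> 'a \<Rightarrow> 'a" where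
  "subst_column \<rho> j a = \<rho> a ! j"

definition group_translation :: "('a::ab_group_add \<Rightarrow> 'a) \<Rightarrow> bool" where
  "group_translation f \<longleftrightarrow> (\<exists>\<beta>. \<forall>a. f a = \<beta> + a)"

definition constant_map :: "('a \<Rightarrow> 'a) \<Rightarrow> bool" where
  "constant_map f \<longleftrightarrow> (\<exists>\<beta>. \<forall>a. f a = \<beta>)"

definition has_dense_orbit :: "('a::topological_space \<Rightarrow> 'a) \<Rightarrow> bool" where
  "has_dense_orbit f \<longleftrightarrow> (\<exists>a. closure (range (\<lambda>n::nat. (f ^^ n) a)) = UNIV)"

definition subst_word :: "('a \<Rightarrow> 'a list) \<Rightarrow> 'a list \<Rightarrow> 'a list" where
  "subst_word \<rho> w = concat (map \<rho> w)"

definition subst_iter :: "('a \<Rightarrow> 'a list) \<Rightarrow> nat \<Rightarrow> 'a \<Rightarrow> 'a list" where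
  "subst_iter \<rho> k a = (subst_word \<rho> ^^ k) [a]"

definition primitive :: "('a::topological_space \<Rightarrow> 'a list) \<Rightarrow> bool" where
  "primitive \<rho> \<longleftrightarrow>
     (\<forall>U. open U \<and> U \<noteq> {} \<longrightarrow> (\<exists>p. \<forall>a. set (subst_iter \<rho> p a) \<inter> U \<noteq> {}))"

definition language :: "('a::topological_space \<Rightarrow> 'a list) \<Rightarrow> nat \<Rightarrow> 'a list set" where
  "language \<rho> n =
     words_of_length n closure_of
       {w. length w = n \<and> (\<exists>a. \<exists>k\<ge>1. sublist w (subst_iter \<rho> k a))}"

definition subshift :: "('a::topological_space \<Rightarrow> 'a list) \<Rightarrow> (int \<Rightarrow> 'a) set" where
  "subshift \<rho> = {w. \<forall>i j. i \<le> j \<longrightarrow> map w [i..j] \<in> language \<rho> (nat (j - i + 1))}"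

definition left_shift :: "(int \<Rightarrow> 'a) \<Rightarrow> int \<Rightarrow> 'a" where
  "left_shift w = (\<lambda>n. w (n + 1))"

section \<open>Topological and measurable dynamics\<close>

definition minimal_system :: "'x::topological_space set \<Rightarrow> ('x \<Rightarrow> 'x) \<Rightarrow> bool" where
  "minimal_system X T \<longleftrightarrow>
     X \<noteq> {} \<and>
     (\<forall>Y. closedin (top_of_set X) Y \<and> Y \<noteq> {} \<and> T ` Y \<subseteq> Y \<longrightarrow> Y = X)"

text \<open>
  The alphabet need not be metrizable, so regularity of Borel measures is not automatic and has
  to be required. For finite Borel measures on a compact Hausdorff space, inner regularity with
  respect to compact sets implies outer regularity with respect to open sets.
\<close>

definition regular_borel_prob :: "'x::topological_space set \<Rightarrow> 'x measure \<Rightarrow> bool" where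
  "regular_borel_prob X M \<longleftrightarrow>
     prob_space M \<and> space M = X \<and> sets M = sets (restrict_space borel X) \<and>
     (\<forall>E\<in>sets M. emeasure M E = (SUP K\<in>{K. compact K \<and> K \<subseteq> E}. emeasure M K))"

definition invariant_prob ::
    "'x::topological_space set \<Rightarrow> ('x \<Rightarrow> 'x) \<Rightarrow> 'x measure \<Rightarrow> bool" where
  "invariant_prob X T M \<longleftrightarrow>
     regular_borel_prob X M \<and> T \<in> measurable M M \<and> distr M M T = M"

definition uniquely_ergodic :: "'x::topological_space set \<Rightarrow> ('x \<Rightarrow> 'x) \<Rightarrow> bool" where
  "uniquely_ergodic X T \<longleftrightarrow> (\<exists>!M. invariant_prob X T M)"

definition strictly_ergodic :: "'x::topological_space set \<Rightarrow> ('x \<Rightarrow> 'x) \<Rightarrow> bool" where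
  "strictly_ergodic X T \<longleftrightarrow> minimal_system X T \<and> uniquely_ergodic X T"

text \<open>
  Elements of \<open>L\<^sup>2(M)\<close> are represented by square-integrable functions, with equality almost
  everywhere. Orthonormality prevents a set of such functions from containing two
  representatives of the same class.
\<close>

definition square_integrable :: "'x measure \<Rightarrow> ('x \<Rightarrow> complex) \<Rightarrow> bool" where
  "square_integrable M f \<longleftrightarrow>
     f \<in> borel_measurable M \<and> integrable M (\<lambda>x. (cmod (f x))\<^sup>2)"

definition orthonormal_basis :: "'x measure \<Rightarrow> ('x \<Rightarrow> complex) set \<Rightarrow> bool" where
  "orthonormal_basis M B \<longleftrightarrow>
     (\<forall>f\<in>B. square_integrable M f) \<and>
     (\<forall>f\<in>B. \<forall>g\<in>B. (LINT x|M. f x * cnj (g x)) = (if f = g then 1 else 0)) \<and>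
     (\<forall>h. square_integrable M h \<longrightarrow>
        (\<forall>\<epsilon>>0. \<exists>F c. finite F \<and> F \<subseteq> B \<and>
           (LINT x|M. (cmod (h x - (\<Sum>f\<in>F. c f * f x)))\<^sup>2) < \<epsilon>))"

definition koopman_eigenfunction :: "'x measure \<Rightarrow> ('x \<Rightarrow> 'x) \<Rightarrow> ('x \<Rightarrow> complex) \<Rightarrow> bool" where
  "koopman_eigenfunction M T f \<longleftrightarrow>
     square_integrable M f \<and> \<not> (AE x in M. f x = 0) \<and>
     (\<exists>c. AE x in M. f (T x) = c * f x)"

definition pure_point_spectrum :: "'x measure \<Rightarrow> ('x \<Rightarrow> 'x) \<Rightarrow> bool" where
  "pure_point_spectrum M T \<longleftrightarrow>
     (\<exists>B. orthonormal_basis M B \<and> (\<forall>f\<in>B. koopman_eigenfunction M T f))"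

end

theory Submission
  imports Defs
begin

text \<open>
  Because of the constant column, all but a proportion \<open>((L - 1) / L) ^ k\<close> of the columns of
  \<open>\<rho>\<^sup>k\<close> are constant. Hence a point of the subshift is determined, off a set of coordinates of
  that density, by the residue modulo \<open>L ^ k\<close> at which it is cut into blocks \<open>\<rho>\<^sup>k(a)\<close>. So twisted
  ergodic averages of cylinder sets over \<open>L ^ k\<close> steps agree, up to the phase given by this residue,
  with those of one periodic point. This gives uniqueness of the invariant measure, pointwise
  convergence of the averages at roots of unity of order \<open>L ^ k\<close>, and the fact that the limits are
  eigenfunctions which are unique up to scalars and span a dense subspace. The invariant measure
  is the image of the Haar measure on the \<open>L\<close>-adic integers under the almost everywhere
  continuous map reading off a Toeplitz sequence, whence its regularity.
\<close>

section \<open>Substitutions of constant length\<close>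

text \<open>Letter \<open>l\<close> of \<open>it k a\<close> arises from \<open>a\<close> by
  composing columns of \<rho> selected by the base-\<open>L\<close> digits of \<open>l\<close>, most
  significant digit first. One digit naming a constant column therefore erases \<open>a\<close> and
  all higher digits; this is why the proportion of nonconstant columns decays geometrically. Two
  obstacles shape the proof. The language is a closure, so windows of a point are only limits of
  legal words; exact equality is recovered at constant columns because only finitely many letters
  occur there. Also, the residue at which a point is cut need not be unique, so no function of the
  point is made out of it: eigenfunctions are limits of averages and not powers of \<zeta> with the
  residue as exponent. Measures of cylinders are compared with the explicit numbers
  \<open>periodic_average 1 k V\<close>, which depend on neither a point nor a measure. The same
  comparison yields uniqueness and the invariance of the constructed measure, so no addition is set
  up on digit sequences. The dense translation enters through primitivity, which drives
  minimality.\<close>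

lemma concat_map_nth:
  assumes "\<And>x. x \<in> set xs \<Longrightarrow> length (f x) = N" "i < length xs" "j < N"
  shows "concat (map f xs) ! (i * N + j) = f (xs ! i) ! j"
  using assms
proof (induction xs arbitrary: i)
  case (Cons x xs)
  show ?case
  proof (cases i)
    case 0
    then show ?thesis using Cons.prems by (simp add: nth_append)
  next
    case (Suc i')
    with Cons show ?thesis by (simp add: nth_append add.assoc)
  qed
qed simp

lemma funpow_subst_word: "(subst_word \<rho> ^^ k) w = concat (map (subst_iter \<rho> k) w)"
proof -
  have append: "(subst_word \<rho> ^^ k) (u @ v) = (subst_word \<rho> ^^ k) u @ (subst_word \<rho> ^^ k) v" for u v
    by (induction k) (auto simp: subst_word_def)
  have nil: "(subst_word \<rho> ^^ k) [] = []"
    by (induction k) (auto simp: subst_word_def)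
  show ?thesis
  proof (induction w)
    case (Cons a w)
    then show ?case using append[of "[a]" w] by (simp add: subst_iter_def)
  qed (simp add: nil)
qed

lemma subst_iter_add:
  "subst_iter \<rho> (m + k) a = concat (map (subst_iter \<rho> k) (subst_iter \<rho> m a))"
  by (subst add.commute, subst subst_iter_def)
    (simp add: funpow_add funpow_subst_word[of k \<rho>] flip: subst_iter_def)

text \<open>The letter 0 is just a reference: a column is constant exactly if it always equals its
  value there. The map is a parameter because the definition is applied to iterates.\<close>

definition nonconstant_columns :: "('a::zero \<Rightarrow> 'a list) \<Rightarrow> nat \<Rightarrow> nat set" where
  "nonconstant_columns \<rho> N = {j. j < N \<and> (\<exists>a. \<rho> a ! j \<noteq> \<rho> 0 ! j)}"

lemma finite_nonconstant_columns [simp]: "finite (nonconstant_columns \<rho> N)"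
  unfolding nonconstant_columns_def by simp

section \<open>Columns of the iterates\<close>

locale column_substitution =
  fixes \<rho> :: "'a::{topological_ab_group_add, t2_space} \<Rightarrow> 'a list" and L :: nat
  assumes L_ge_2: "2 \<le> L"
    and const_length: "constant_length \<rho> L"
    and columns: "j < L \<Longrightarrow>
      group_translation (subst_column \<rho> j) \<or> constant_map (subst_column \<rho> j)"
    and ex_constant: "\<exists>j<L. constant_map (subst_column \<rho> j)"
    and ex_translation:
      "\<exists>j<L. group_translation (subst_column \<rho> j) \<and> has_dense_orbit (subst_column \<rho> j)"
    and compact_alphabet: "compact (UNIV :: 'a set)"
begin

abbreviation "it \<equiv> subst_iter \<rho>"
abbreviation "NC k \<equiv> nonconstant_columns (it k) (L ^ k)"

lemma L_pos [simp]: "0 < L" "L \<noteq> 0" "Suc 0 < L"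
  using L_ge_2 by auto

lemma length_it [simp]: "length (it k a) = L ^ k"
proof (induction k arbitrary: a)
  case (Suc k)
  have "length (concat (map \<rho> w)) = length w * L" for w
    using const_length by (induction w) (auto simp: constant_length_def)
  then have "length (it (Suc k) a) = length (it k a) * L"
    by (simp add: subst_iter_def subst_word_def)
  then show ?case using Suc by simp
qed (simp add: subst_iter_def)

lemma it_1: "it (Suc 0) a = \<rho> a"
  by (simp add: subst_iter_def subst_word_def)

lemma it_0 [simp]: "it 0 a = [a]"
  by (simp add: subst_iter_def)

text \<open>Columns compose: the high part \<open>i\<close> of the index selects the column applied
  first, the low part \<open>j\<close> the column applied to its result.\<close>

lemma it_add_nth:
  assumes "i < L ^ m" "j < L ^ k"
  shows "it (m + k) a ! (i * L ^ k + j) = it k (it m a ! i) ! j"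
  unfolding subst_iter_add by (rule concat_map_nth) (use assms in auto)

lemma it_nth:
  assumes "l < L ^ n" "k \<le> n"
  shows "it n a ! l = it k (it (n - k) a ! (l div L ^ k)) ! (l mod L ^ k)"
proof -
  have "l div L ^ k < L ^ (n - k)"
    using assms by (simp add: less_mult_imp_div_less flip: power_add)
  from it_add_nth[OF this, of "l mod L ^ k" k a] assms(2) show ?thesis
    unfolding div_mult_mod_eq by simp
qed

text \<open>Two translations compose to a translation, and a constant factor on either side makes
  the composite constant.\<close>

lemma column_cases:
  assumes "j < L ^ k"
  shows "(\<exists>\<beta>. \<forall>a. it k a ! j = \<beta> + a) \<or> (\<exists>\<beta>. \<forall>a. it k a ! j = \<beta>)"
  using assms
proof (induction k arbitrary: j)
  case (Suc k)
  have i: "j div L < L ^ k" using Suc.prems by (simp add: less_mult_imp_div_less mult.commute)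
  have eq: "it (Suc k) a ! j = \<rho> (it k a ! (j div L)) ! (j mod L)" for a
    using it_nth[OF Suc.prems, of 1] by (simp add: it_1)
  have "(\<exists>\<beta>. \<forall>a. \<rho> a ! (j mod L) = \<beta> + a) \<or> (\<exists>\<beta>. \<forall>a. \<rho> a ! (j mod L) = \<beta>)"
    using columns[of "j mod L"] by (auto simp: group_translation_def constant_map_def subst_column_def)
  with Suc.IH[OF i] show ?case unfolding eq by (auto simp: add.assoc[symmetric])
qed (auto intro: exI[of _ 0])

lemma continuous_column:
  assumes "j < L ^ k"
  shows "continuous_on UNIV (\<lambda>a. it k a ! j)"
  using column_cases[OF assms] by (auto intro!: continuous_intros)

lemma NC_less: "j \<in> NC k \<Longrightarrow> j < L ^ k"
  by (simp add: nonconstant_columns_def)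

lemma column_eq: "j < L ^ k \<Longrightarrow> j \<notin> NC k \<Longrightarrow> it k a ! j = it k 0 ! j"
  by (auto simp: nonconstant_columns_def)

text \<open>Everything above the low \<open>k\<close> digits merely supplies the argument of a
  constant column.\<close>

lemma it_nth_const:
  assumes "l < L ^ n" "k \<le> n" "l mod L ^ k \<notin> NC k"
  shows "it n a ! l = it k 0 ! (l mod L ^ k)"
  unfolding it_nth[OF assms(1,2), of a] by (rule column_eq[OF _ assms(3)]) simp

lemma NC_mod:
  assumes "l \<in> NC n" "k \<le> n"
  shows "l mod L ^ k \<in> NC k"
proof (rule ccontr)
  assume "l mod L ^ k \<notin> NC k"
  then have "it n a ! l = it n 0 ! l" for a
    by (metis NC_less assms it_nth_const)
  with assms show False by (auto simp: nonconstant_columns_def)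
qed

text \<open>An index is nonconstant only if its leading digits and its last digit both are, so the
  cardinalities are submultiplicative; the constant column leaves at most \<open>L - 1\<close>
  choices for a single digit.\<close>

lemma card_NC: "card (NC k) \<le> (L - 1) ^ k"
proof (induction k)
  case 0
  have "NC 0 \<subseteq> {0}" by (auto simp: nonconstant_columns_def)
  then show ?case using card_mono[of "{0}" "NC 0"] by (simp del: it_0)
next
  case (Suc k)
  have "NC (Suc k) \<subseteq> (\<lambda>(i, j). i * L + j) ` (NC k \<times> NC 1)"
  proof
    fix l assume l: "l \<in> NC (Suc k)"
    have m: "l mod L \<in> NC 1" using NC_mod[OF l, of 1] by simp
    have "l div L \<in> NC k"
    proof (rule ccontr)
      assume n: "l div L \<notin> NC k"
      have "l < L ^ Suc k" using NC_less[OF l] .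
      moreover from this have "l div L < L ^ k" by (simp add: less_mult_imp_div_less mult.commute)
      ultimately have "it (Suc k) a ! l = it 1 (it k 0 ! (l div L)) ! (l mod L)" for a
        using column_eq[OF _ n, of a] by (subst it_nth[of l "Suc k" 1]) simp_all
      then have "it (Suc k) a ! l = it (Suc k) 0 ! l" for a by presburger
      with l show False by (auto simp: nonconstant_columns_def)
    qed
    with m show "l \<in> (\<lambda>(i, j). i * L + j) ` (NC k \<times> NC 1)"
      by (intro image_eqI[of _ _ "(l div L, l mod L)"]) auto
  qed
  then have "card (NC (Suc k)) \<le> card ((\<lambda>(i, j). i * L + j) ` (NC k \<times> NC 1))"
    by (rule card_mono[rotated]) simp
  also have "\<dots> \<le> card (NC k \<times> NC 1)" by (rule card_image_le) simp
  finally have "card (NC (Suc k)) \<le> card (NC k) * card (NC 1)"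
    by (simp only: card_cartesian_product)
  moreover obtain c where c: "c < L" "constant_map (subst_column \<rho> c)" using ex_constant by blast
  then have "NC 1 \<subseteq> {..<L} - {c}"
    by (auto simp: nonconstant_columns_def it_1 constant_map_def subst_column_def)
  from card_mono[OF _ this] c have "card (NC 1) \<le> L - 1" by simp
  ultimately show ?case using Suc by (simp add: le_trans mult.commute mult_le_mono)
qed

text \<open>The letter \<open>b\<close> of the constant column occurs in every
  \<open>\<rho> x\<close>, and following the translation column from \<open>b\<close> places
  \<open>(t ^^ n) b\<close> in \<open>it n b\<close>. The start no longer depends on
  \<open>x\<close>, so one \<open>n\<close> serves all letters.\<close>

lemma primitive_substitution: "primitive \<rho>"
  unfolding primitive_def
proof (intro allI impI)
  fix U :: "'a set" assume U: "open U \<and> U \<noteq> {}"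
  obtain j \<beta> where j: "j < L" "\<And>a. \<rho> a ! j = \<beta> + a" "has_dense_orbit (subst_column \<rho> j)"
    using ex_translation by (auto simp: group_translation_def subst_column_def)
  obtain c b where c: "c < L" "\<And>a. \<rho> a ! c = b"
    using ex_constant by (auto simp: constant_map_def subst_column_def)
  define t where "t = subst_column \<rho> j"
  obtain a where a: "closure (range (\<lambda>n::nat. (t ^^ n) a)) = UNIV"
    using j by (auto simp: has_dense_orbit_def t_def)
  \<comment> \<open>Two orbits of a translation differ by a fixed translation, so density passes
    from the orbit of \<open>a\<close> to that of \<open>b\<close>.\<close>
  have shift: "(t ^^ n) b = (t ^^ n) a + (b - a)" for n
    by (induction n) (simp_all add: t_def subst_column_def j)
  let ?V = "(\<lambda>x. x + (b - a)) -` U"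
  have "open ?V" using U by (intro open_vimage continuous_intros) auto
  moreover obtain u where "u \<in> U" using U by blast
  then have "u - (b - a) \<in> ?V" by simp
  ultimately have "?V \<inter> range (\<lambda>n::nat. (t ^^ n) a) \<noteq> {}"
    using a by (metis UNIV_I closure_iff_nhds_not_empty disjoint_iff equalityD1)
  then obtain n where n: "(t ^^ n) b \<in> U" by (auto simp: shift)
  have in_it: "(t ^^ n) x \<in> set (it n x)" for n x
  proof (induction n)
    case (Suc n)
    have "t y \<in> set (\<rho> y)" for y
      using nth_mem[of j "\<rho> y"] j(1) const_length
      by (simp add: t_def subst_column_def constant_length_def)
    with Suc show ?case by (auto simp: subst_iter_def subst_word_def)
  qed simp
  have "b \<in> set (it 1 x)" for x
    using c const_length nth_mem[of c "\<rho> x"] by (simp add: it_1 constant_length_def)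
  with in_it[of n b] have "(t ^^ n) b \<in> set (it (1 + n) x)" for x
    unfolding subst_iter_add by auto
  with n show "\<exists>p. \<forall>x. set (it p x) \<inter> U \<noteq> {}" by blast
qed

end

section \<open>The subshift\<close>

lemma open_box_words_of_length:
  assumes "\<And>u. u < n \<Longrightarrow> open (Ob u)"
  shows "openin (words_of_length n) {w. length w = n \<and> (\<forall>u<n. w ! u \<in> Ob u)}"
proof -
  let ?B = "\<Pi>\<^sub>E u\<in>{..<n}. Ob u"
  have "openin (product_topology (\<lambda>_. euclidean) {..<n}) ?B"
    using assms by (subst openin_PiE) auto
  moreover have "{w. length w = n \<and> (\<forall>u<n. w ! u \<in> Ob u)}
      = (\<lambda>w. \<lambda>i\<in>{..<n}. w ! i) -` ?B \<inter> {w. length w = n}"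
    by (auto simp: PiE_def Pi_def)
  ultimately show ?thesis
    unfolding words_of_length_def openin_pullback_topology by blast
qed

lemma sublist_iff_nth:
  "sublist w v \<longleftrightarrow> (\<exists>s. s + length w \<le> length v \<and> (\<forall>u<length w. w ! u = v ! (s + u)))"
proof
  assume "sublist w v"
  then obtain p q where "v = p @ w @ q" by (auto simp: sublist_def)
  then show "\<exists>s. s + length w \<le> length v \<and> (\<forall>u<length w. w ! u = v ! (s + u))"
    by (intro exI[of _ "length p"]) (auto simp: nth_append)
next
  assume "\<exists>s. s + length w \<le> length v \<and> (\<forall>u<length w. w ! u = v ! (s + u))"
  then obtain s where s: "s + length w \<le> length v" "\<forall>u<length w. w ! u = v ! (s + u)" by blast
  then have "w = take (length w) (drop s v)" by (intro nth_equalityI) auto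
  then have "v = take s v @ w @ drop (length w) (drop s v)" by (metis append_take_drop_id)
  then show "sublist w v" unfolding sublist_def by blast
qed

lemma map_upto_nat:
  "map x [i..i + int n - 1] = map (\<lambda>u. x (i + int u)) [0..<n]"
  by (rule nth_equalityI) auto

lemma topspace_words_of_length: "topspace (words_of_length n) = {w. length w = n}"
  by (auto simp: words_of_length_def topspace_pullback_topology)

lemma subshift_iff:
  "x \<in> subshift \<rho> \<longleftrightarrow>
     (\<forall>i n. n \<ge> 1 \<longrightarrow> map (\<lambda>u. x (i + int u)) [0..<n] \<in> language \<rho> n)"
proof
  assume x: "x \<in> subshift \<rho>"
  show "\<forall>i n. n \<ge> 1 \<longrightarrow> map (\<lambda>u. x (i + int u)) [0..<n] \<in> language \<rho> n"
  proof (intro allI impI)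
    fix i :: int and n :: nat assume "n \<ge> 1"
    then have "i \<le> i + int n - 1" by simp
    with x have "map x [i..i + int n - 1] \<in> language \<rho> (nat (i + int n - 1 - i + 1))"
      unfolding subshift_def by blast
    then show "map (\<lambda>u. x (i + int u)) [0..<n] \<in> language \<rho> n"
      by (simp add: map_upto_nat)
  qed
next
  assume x: "\<forall>i n. n \<ge> 1 \<longrightarrow> map (\<lambda>u. x (i + int u)) [0..<n] \<in> language \<rho> n"
  show "x \<in> subshift \<rho>"
    unfolding subshift_def
  proof (intro CollectI allI impI)
    fix i j :: int assume "i \<le> j"
    then show "map x [i..j] \<in> language \<rho> (nat (j - i + 1))"
      using x[rule_format, of "nat (j - i + 1)" i] map_upto_nat[of x i "nat (j - i + 1)"] by simp
  qed
qed

lemma left_shift_subshift: "x \<in> subshift \<rho> \<Longrightarrow> left_shift x \<in> subshift \<rho>"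
  unfolding subshift_iff left_shift_def
proof (intro allI impI)
  fix i :: int and n :: nat
  assume x: "\<forall>i n. 1 \<le> n \<longrightarrow> map (\<lambda>u. x (i + int u)) [0..<n] \<in> language \<rho> n" and "1 \<le> n"
  then show "map (\<lambda>u. x (i + int u + 1)) [0..<n] \<in> language \<rho> n"
    using x[rule_format, of n "i + 1"] by (simp add: add_ac)
qed

context column_substitution
begin

text \<open>A window of a point is only in the closure of the legal words. What can be transferred
  to a genuine subword of an iterate is any open condition on finitely many letters.\<close>

lemma subshift_approx:
  assumes x: "x \<in> subshift \<rho>" and n: "n \<ge> 1"
    and Ob: "\<And>u. u < n \<Longrightarrow> open (Ob u) \<and> x (i + int u) \<in> Ob u"
  obtains a k s where "s + n \<le> L ^ k" "\<And>u. u < n \<Longrightarrow> it k a ! (s + u) \<in> Ob u"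
proof -
  let ?B = "{w. length w = n \<and> (\<forall>u<n. w ! u \<in> Ob u)}"
  let ?w = "map (\<lambda>u. x (i + int u)) [0..<n]"
  have "?w \<in> language \<rho> n" using x n by (auto simp: subshift_iff)
  moreover have "openin (words_of_length n) ?B" by (rule open_box_words_of_length) (use Ob in auto)
  moreover have "?w \<in> ?B" using Ob by auto
  ultimately have "\<exists>w. w \<in> {w. length w = n \<and> (\<exists>a. \<exists>k\<ge>1. sublist w (it k a))} \<and> w \<in> ?B"
    unfolding language_def in_closure_of by meson
  then obtain w where w: "w \<in> ?B" "\<exists>a. \<exists>k\<ge>1. sublist w (it k a)" by blast
  then obtain a k s where "s + length w \<le> length (it k a)"
      "\<forall>u<length w. w ! u = it k a ! (s + u)"
    unfolding sublist_iff_nth by blast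
  then show ?thesis using w(1) that[of s k a] by simp
qed

text \<open>For constructed points, whose windows occur exactly; \<open>k \<ge> 1\<close> is the
  condition in \<open>language\<close>.\<close>

lemma subshiftI:
  assumes "\<And>i n. n \<ge> 1 \<Longrightarrow>
    \<exists>a k s. k \<ge> 1 \<and> s + n \<le> L ^ k \<and> (\<forall>u<n. x (i + int u) = it k a ! (s + u))"
  shows "x \<in> subshift \<rho>"
  unfolding subshift_iff
proof (intro allI impI)
  fix i :: int and n :: nat assume n: "1 \<le> n"
  let ?w = "map (\<lambda>u. x (i + int u)) [0..<n]"
  let ?S = "{w. length w = n \<and> (\<exists>a. \<exists>k\<ge>1. sublist w (it k a))}"
  obtain a k s where *: "k \<ge> 1" "s + n \<le> L ^ k" "\<forall>u<n. x (i + int u) = it k a ! (s + u)"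
    using assms[OF n] by blast
  then have "sublist ?w (it k a)"
    unfolding sublist_iff_nth by (intro exI[of _ s]) auto
  with * have "?w \<in> topspace (words_of_length n) \<inter> ?S" by (auto simp: topspace_words_of_length)
  then show "?w \<in> language \<rho> n"
    unfolding language_def by (rule subsetD[OF closure_of_subset_Int])
qed

text \<open>The residue \<open>r\<close> places the origin of \<open>x\<close> within a block of length \<open>L ^ k\<close>, as far as this is
  visible through constant columns; it need not be unique.\<close>

definition resolves :: "nat \<Rightarrow> nat \<Rightarrow> (int \<Rightarrow> 'a) \<Rightarrow> bool" where
  "resolves k r x \<longleftrightarrow> (\<forall>n. nat ((n + int r) mod int (L ^ k)) \<notin> NC k \<longrightarrow>
     x n = it k 0 ! nat ((n + int r) mod int (L ^ k)))"

text \<open>A residue is found for each finite window around the origin; by the pigeonhole principle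
  one of the finitely many residues serves infinitely many window sizes, hence all
  coordinates.\<close>

lemma ex_resolves:
  assumes x: "x \<in> subshift \<rho>"
  obtains r where "resolves k r x"
proof -
  have "\<exists>r<L ^ k. \<forall>n. \<bar>n\<bar> \<le> int m \<longrightarrow> nat ((n + int r) mod int (L ^ k)) \<notin> NC k \<longrightarrow>
      x n = it k 0 ! nat ((n + int r) mod int (L ^ k))" if m: "m \<ge> L ^ k" for m :: nat
  proof -
    \<comment> \<open>Excludes every letter of \<open>it k 0\<close> other than the letter of
      \<open>x\<close> itself. At a constant column the approximating letter comes from this finite
      set, so lying in \<open>Ob u\<close> forces equality.\<close>
    define Ob where "Ob u = - ((\<lambda>j. it k 0 ! j) ` {..<L ^ k} - {x (- int m + int u)})" for u
    have "open (Ob u)" for u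
      unfolding Ob_def by (intro open_Compl finite_imp_closed) auto
    moreover have "x (- int m + int u) \<in> Ob u" for u
      unfolding Ob_def by simp
    ultimately have Ob: "open (Ob u) \<and> x (- int m + int u) \<in> Ob u" for u by blast
    obtain a K s where K: "s + (2 * m + 1) \<le> L ^ K"
        "\<And>u. u < 2 * m + 1 \<Longrightarrow> it K a ! (s + u) \<in> Ob u"
      by (rule subshift_approx[OF x, of "2 * m + 1" Ob "- int m"]) (use Ob in auto)
    \<comment> \<open>The window is at least as long as a block so that the iterate found has level
      at least \<open>k\<close>.\<close>
    have "L ^ k \<le> L ^ K" using K(1) m by linarith
    then have kK: "k \<le> K" using power_increasing_iff[of L k K] by simp
    \<comment> \<open>Coordinate \<open>- m\<close> of \<open>x\<close> is matched with index
      \<open>s\<close> of \<open>it K a\<close>, so the origin is at index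
      \<open>s + m\<close>.\<close>
    show ?thesis
    proof (intro exI[of _ "(s + m) mod L ^ k"] conjI allI impI)
      fix n assume n: "\<bar>n\<bar> \<le> int m"
        and nc: "nat ((n + int ((s + m) mod L ^ k)) mod int (L ^ k)) \<notin> NC k"
      define u where "u = nat (n + int m)"
      have u: "u < 2 * m + 1" "n = - int m + int u" using n by (auto simp: u_def)
      have eq: "nat ((n + int ((s + m) mod L ^ k)) mod int (L ^ k)) = (s + u) mod L ^ k"
      proof -
        have "(n + int ((s + m) mod L ^ k)) mod int (L ^ k) = (n + int (s + m)) mod int (L ^ k)"
          by (simp add: zmod_int mod_simps)
        also have "n + int (s + m) = int (s + u)" using u by simp
        finally show ?thesis by (simp only: zmod_int[symmetric] nat_int)
      qed
      have "it K a ! (s + u) = it k 0 ! ((s + u) mod L ^ k)"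
        using it_nth_const[of "s + u" K k a] K u nc kK unfolding eq by simp
      moreover have "it k 0 ! ((s + u) mod L ^ k) \<in> (\<lambda>j. it k 0 ! j) ` {..<L ^ k}" by simp
      ultimately show "x n = it k 0 ! nat ((n + int ((s + m) mod L ^ k)) mod int (L ^ k))"
        using K(2)[OF u(1)] u(2) unfolding eq Ob_def by simp
    qed simp
  qed
  then have "\<forall>m. \<exists>r. m \<ge> L ^ k \<longrightarrow> r<L ^ k \<and> (\<forall>n. \<bar>n\<bar> \<le> int m \<longrightarrow>
      nat ((n + int r) mod int (L ^ k)) \<notin> NC k \<longrightarrow>
      x n = it k 0 ! nat ((n + int r) mod int (L ^ k)))" by blast
  then obtain R where R: "\<And>m. m \<ge> L ^ k \<Longrightarrow> R m < L ^ k \<and> (\<forall>n. \<bar>n\<bar> \<le> int m \<longrightarrow>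
      nat ((n + int (R m)) mod int (L ^ k)) \<notin> NC k \<longrightarrow>
      x n = it k 0 ! nat ((n + int (R m)) mod int (L ^ k)))" by metis
  have "R ` {L ^ k..} \<subseteq> {..<L ^ k}" using R by auto
  then have "finite (R ` {L ^ k..})" using finite_subset by blast
  from pigeonhole_infinite[OF infinite_Ici this]
  obtain m0 where inf: "infinite {m \<in> {L ^ k..}. R m = R m0}" by blast
  have "resolves k (R m0) x"
    unfolding resolves_def
  proof (intro allI impI)
    fix n assume nc: "nat ((n + int (R m0)) mod int (L ^ k)) \<notin> NC k"
    from inf obtain m where "m \<ge> L ^ k" "R m = R m0" "m > nat \<bar>n\<bar>"
      unfolding infinite_nat_iff_unbounded by auto
    then show "x n = it k 0 ! nat ((n + int (R m0)) mod int (L ^ k))"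
      using R[of m] nc by auto
  qed
  then show ?thesis using that by blast
qed

end

section \<open>Cylinder sets\<close>

text \<open>Without metrizability, disjoint compact sets are separated by sets depending on finitely many
  coordinates; these replace the generating sets of the product \<open>\<sigma>\<close>-algebra.\<close>

definition cylinder :: "int set \<Rightarrow> (int \<Rightarrow> 'a::topological_space) set \<Rightarrow> bool" where
  "cylinder W V \<longleftrightarrow>
     finite W \<and> open V \<and> (\<forall>x y. (\<forall>n\<in>W. x n = y n) \<longrightarrow> (x \<in> V \<longleftrightarrow> y \<in> V))"

lemma open_contains_box:
  fixes U :: "(int \<Rightarrow> 'a::topological_space) set"
  assumes "open U" "x \<in> U"
  obtains W B where "finite W" "\<And>n. open (B n)" "\<And>n. x n \<in> B n"
    "\<And>y. (\<And>n. n \<in> W \<Longrightarrow> y n \<in> B n) \<Longrightarrow> y \<in> U"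
proof -
  have "openin (product_topology (\<lambda>_. euclidean) UNIV) U" using assms by (simp add: open_fun_def)
  from product_topology_open_contains_basis[OF this assms(2)]
  obtain B where B: "x \<in> (\<Pi>\<^sub>E i\<in>UNIV. B i)" "\<And>i. open (B i)"
    "finite {i. B i \<noteq> UNIV}" "(\<Pi>\<^sub>E i\<in>UNIV. B i) \<subseteq> U" by auto
  show thesis
  proof (rule that[OF B(3,2)])
    show "x n \<in> B n" for n using B(1) by auto
    fix y assume "\<And>n. n \<in> {i. B i \<noteq> UNIV} \<Longrightarrow> y n \<in> B n"
    then have "y \<in> (\<Pi>\<^sub>E i\<in>UNIV. B i)" by (auto simp: PiE_iff)
    with B(4) show "y \<in> U" by blast
  qed
qed

lemma open_contains_cylinder:
  fixes U :: "(int \<Rightarrow> 'a::topological_space) set"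
  assumes "open U" "x \<in> U"
  obtains W V where "cylinder W V" "x \<in> V" "V \<subseteq> U"
proof -
  obtain W B where WB: "finite W" "\<And>n. open (B n)" "\<And>n. x n \<in> B n"
    "\<And>y. (\<And>n. n \<in> W \<Longrightarrow> y n \<in> B n) \<Longrightarrow> y \<in> U"
    by (rule open_contains_box[OF assms]) blast
  show thesis
  proof (rule that)
    show "cylinder W {y. \<forall>n\<in>W. y n \<in> B n}"
      unfolding cylinder_def
      using WB(1) product_topology_basis'[OF WB(1), of B "\<lambda>n. n"] WB(2) by auto
  qed (use WB in auto)
qed

lemma cylinder_UNION:
  fixes V :: "'i \<Rightarrow> (int \<Rightarrow> 'a::topological_space) set"
  assumes "finite I" "\<And>i. i \<in> I \<Longrightarrow> cylinder (W i) (V i)"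
  shows "cylinder (\<Union>i\<in>I. W i) (\<Union>i\<in>I. V i)"
  unfolding cylinder_def
proof (intro conjI allI impI)
  show "finite (\<Union>i\<in>I. W i)" "open (\<Union>i\<in>I. V i)"
    using assms by (auto simp: cylinder_def)
  fix x y :: "int \<Rightarrow> 'a" assume xy: "\<forall>n\<in>(\<Union>i\<in>I. W i). x n = y n"
  have "x \<in> V i \<longleftrightarrow> y \<in> V i" if i: "i \<in> I" for i
  proof -
    have "\<forall>n\<in>W i. x n = y n" using i by (auto intro!: xy[rule_format])
    with assms(2)[OF i, unfolded cylinder_def, THEN conjunct2, THEN conjunct2, rule_format, of x y]
    show ?thesis by simp
  qed
  then show "x \<in> (\<Union>i\<in>I. V i) \<longleftrightarrow> y \<in> (\<Union>i\<in>I. V i)" by blast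
qed

lemma compact_subset_cylinder:
  fixes U :: "(int \<Rightarrow> 'a::topological_space) set"
  assumes K: "compact K" and U: "open U" "K \<subseteq> U"
  obtains W V where "cylinder W V" "K \<subseteq> V" "V \<subseteq> U"
proof -
  have "\<exists>W V. cylinder W V \<and> x \<in> V \<and> V \<subseteq> U" if "x \<in> K" for x
  proof -
    from that U have "x \<in> U" by blast
    then show ?thesis by (rule open_contains_cylinder[OF U(1)]) blast
  qed
  then obtain W V where WV: "\<And>x. x \<in> K \<Longrightarrow> cylinder (W x) (V x) \<and> x \<in> V x \<and> V x \<subseteq> U"
    by metis
  then have "K \<subseteq> (\<Union>x\<in>K. V x)" "\<And>x. x \<in> K \<Longrightarrow> open (V x)" by (auto simp: cylinder_def)
  from compactE_image[OF K this(2,1)] obtain I where "I \<subseteq> K" "finite I" "K \<subseteq> (\<Union>x\<in>I. V x)"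
    by blast
  with WV show thesis
    by (intro that[OF cylinder_UNION[of I W V]]) auto
qed

text \<open>Regularity of the alphabet. The closure leaves room for approximating a second point in
  the minimality proof.\<close>

lemma compact_t2_open_shrink:
  fixes x :: "'a::t2_space"
  assumes "compact (UNIV :: 'a set)" "open U" "x \<in> U"
  obtains V where "open V" "x \<in> V" "closure V \<subseteq> U"
proof -
  have "regular_space (euclidean :: 'a topology)"
    using assms(1) by (intro compact_Hausdorff_imp_regular_space)
      (simp_all add: compact_space_def Hausdorff_space_def separation_t2 disjnt_def)
  moreover have "closedin euclidean (- U)" "x \<in> topspace euclidean - (- U)"
    using assms by auto
  ultimately obtain V where "openin euclidean V" "x \<in> V" "disjnt (- U) (euclidean closure_of V)"
    unfolding regular_space by blast
  then show thesis using that[of V] by (auto simp: disjnt_iff)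
qed

section \<open>Minimality\<close>

context column_substitution
begin

text \<open>Uniform recurrence: a window of \<open>x\<close> occurs approximately in some
  \<open>it k a\<close>, which is an open condition on \<open>a\<close>, so by primitivity it occurs
  in \<open>it (p + k) b\<close> for every \<open>b\<close>. A window of \<open>y\<close> of length
  \<open>2 * Q\<close> contains such a block up to approximation, and a forward shift of
  \<open>y\<close> enters the given neighbourhood of \<open>x\<close>.\<close>

lemma minimal_subshift:
  assumes "subshift \<rho> \<noteq> {}"
  shows "minimal_system (subshift \<rho>) left_shift"
  unfolding minimal_system_def
proof (intro conjI allI impI)
  fix Y assume "closedin (top_of_set (subshift \<rho>)) Y \<and> Y \<noteq> {} \<and> left_shift ` Y \<subseteq> Y"
  then obtain C y where C: "closed C" "Y = subshift \<rho> \<inter> C" "y \<in> Y" and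
    inv: "left_shift ` Y \<subseteq> Y" by (auto simp: closedin_closed)
  have funpow_in: "(\<lambda>n. y (n + int i)) \<in> Y" for i
  proof (induction i)
    case (Suc i)
    then have "left_shift (\<lambda>n. y (n + int i)) \<in> Y" using inv by blast
    then show ?case by (simp add: left_shift_def add_ac)
  qed (use C in simp)
  have "x \<in> C" if x: "x \<in> subshift \<rho>" for x
  proof (rule ccontr)
    assume "x \<notin> C"
    then obtain W B where WB: "finite W" "\<And>n. open (B n)" "\<And>n. x n \<in> B n"
      "\<And>z. (\<And>n. n \<in> W \<Longrightarrow> z n \<in> B n) \<Longrightarrow> z \<in> - C"
      using open_contains_box[of "- C" x] C by (auto simp: open_Compl)
    have "\<exists>V. open V \<and> x n \<in> V \<and> closure V \<subseteq> B n" for n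
      using compact_t2_open_shrink[OF compact_alphabet WB(2,3)] by metis
    then obtain B' where B': "\<And>n. open (B' n)" "\<And>n. x n \<in> B' n" "\<And>n. closure (B' n) \<subseteq> B n"
      by metis
    obtain m where m: "\<And>n. n \<in> W \<Longrightarrow> \<bar>n\<bar> \<le> int m"
    proof -
      have "\<bar>n\<bar> \<le> int (nat (\<Sum>n\<in>W. \<bar>n\<bar>))" if "n \<in> W" for n
        using member_le_sum[OF that, of "\<lambda>n. \<bar>n\<bar>"] WB(1) by simp
      then show thesis by (rule that)
    qed
    define M where "M = 2 * m + 1"
    obtain a k s where s: "s + M \<le> L ^ k"
      "\<And>u. u < M \<Longrightarrow> it k a ! (s + u) \<in> B' (- int m + int u)"
      by (rule subshift_approx[OF x, of M "\<lambda>u. B' (- int m + int u)" "- int m"])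
        (use B' in \<open>auto simp: M_def\<close>)
    define A where "A = (\<Inter>u\<in>{..<M}. (\<lambda>b. it k b ! (s + u)) -` B' (- int m + int u))"
    have "open A"
      unfolding A_def using s(1) B'(1)
      by (intro open_INT finite_lessThan ballI open_vimage continuous_column) auto
    moreover have "a \<in> A" using s(2) by (auto simp: A_def)
    ultimately obtain p where p: "\<And>b. set (it p b) \<inter> A \<noteq> {}"
      using primitive_substitution unfolding primitive_def by blast
    define Q where "Q = L ^ (p + k)"
    have "\<exists>s'. s' + M \<le> Q \<and> (\<forall>u<M. it (p + k) b ! (s' + u) \<in> B' (- int m + int u))" for b
    proof -
      from p[of b] obtain i where i: "i < L ^ p" "it p b ! i \<in> A"
        by (metis disjoint_iff in_set_conv_nth length_it)
      have "(i + 1) * L ^ k \<le> L ^ p * L ^ k" using i(1) by (intro mult_right_mono) auto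
      then have "i * L ^ k + s + M \<le> Q" using s(1) by (simp add: Q_def power_add)
      moreover have "it (p + k) b ! (i * L ^ k + s + u) \<in> B' (- int m + int u)" if "u < M" for u
        using it_add_nth[OF i(1), of "s + u" k b] i(2) that s(1) by (simp add: A_def add.assoc)
      ultimately show ?thesis by blast
    qed
    then obtain S where S: "\<And>b. S b + M \<le> Q"
      "\<And>b u. u < M \<Longrightarrow> it (p + k) b ! (S b + u) \<in> B' (- int m + int u)" by metis
    \<comment> \<open>A neighbourhood of the letter of \<open>y\<close> with this property: if an
      approximating letter in \<open>E u\<close> also lies in \<open>B' n\<close>, then the letter
      of \<open>y\<close> lies in \<open>B n\<close>. Here it matters that the closure of
      \<open>B' n\<close> is inside \<open>B n\<close>.\<close>
    define E where "E u = (\<Inter>n\<in>{n \<in> {- int m..int m}. y (- int m + int u) \<notin> B n}. - closure (B' n))"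
      for u
    have Q_pos: "Q \<ge> 1" by (simp add: Q_def Suc_leI)
    \<comment> \<open>Wherever it starts, a stretch of \<open>2 * Q\<close> letters contains a whole
      aligned block of length \<open>Q\<close>. The window begins at \<open>- m\<close> so that the
      shift \<open>i\<close> below is nonnegative: \<open>Y\<close> is only forward
      invariant.\<close>
    obtain b K t where t: "t + 2 * Q \<le> L ^ K" "\<And>u. u < 2 * Q \<Longrightarrow> it K b ! (t + u) \<in> E u"
    proof (rule subshift_approx[of y "2 * Q" E "- int m"])
      show "y \<in> subshift \<rho>" using C by simp
      have "finite {n \<in> {- int m..int m}. y (- int m + int u) \<notin> B n}" for u
        by (rule finite_subset[of _ "{- int m..int m}"]) auto
      then show "open (E u) \<and> y (- int m + int u) \<in> E u" for u
        unfolding E_def using B'(3) by (auto intro!: open_INT)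
    qed (use Q_pos in auto)
    have "Q \<le> L ^ K" using t(1) Q_pos by linarith
    then have pkK: "p + k \<le> K" using power_increasing_iff[of L "p + k" K] by (simp add: Q_def)
    \<comment> \<open>The ceiling of \<open>t / Q\<close>, giving the first aligned block that
      starts at or after \<open>t\<close>.\<close>
    define q where "q = (t + Q - 1) div Q"
    have q: "t \<le> q * Q" "q * Q < t + Q"
    proof -
      have "t + Q - 1 = q * Q + (t + Q - 1) mod Q" "(t + Q - 1) mod Q < Q"
        using Q_pos by (simp_all add: q_def)
      then show "t \<le> q * Q" "q * Q < t + Q" using Q_pos by linarith+
    qed
    define b' where "b' = it (K - (p + k)) b ! q"
    have block: "it K b ! (q * Q + v) = it (p + k) b' ! v" if "v < Q" for v
    proof -
      have "q * Q + v < L ^ K" using that q t(1) by linarith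
      moreover have "(q * Q + v) div Q = q" "(q * Q + v) mod Q = v" using that by simp_all
      ultimately show ?thesis
        using it_nth[of "q * Q + v" K "p + k" b] pkK by (simp add: b'_def Q_def)
    qed
    define i where "i = q * Q + S b' - t"
    have "(\<lambda>n. y (n + int i)) \<in> - C"
    proof (rule WB(4), rule ccontr)
      fix n assume n: "n \<in> W" "y (n + int i) \<notin> B n"
      define u where "u = nat (n + int m)"
      have u: "u < M" "n = - int m + int u" using m[OF n(1)] by (auto simp: u_def M_def)
      have iu: "t + (i + u) = q * Q + (S b' + u)" using q(1) by (simp add: i_def)
      have "i + u < 2 * Q" using S(1)[of b'] u(1) q(2) iu by linarith
      then have "it K b ! (t + (i + u)) \<in> E (i + u)" by (rule t(2))
      moreover have "it K b ! (t + (i + u)) = it (p + k) b' ! (S b' + u)"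
        unfolding iu by (rule block) (use S(1)[of b'] u(1) in linarith)
      ultimately have "it (p + k) b' ! (S b' + u) \<in> E (i + u)" by simp
      moreover have "n \<in> {n \<in> {- int m..int m}. y (- int m + int (i + u)) \<notin> B n}"
        using n u m[OF n(1)] by (auto simp: add_ac)
      ultimately have "it (p + k) b' ! (S b' + u) \<notin> closure (B' n)" unfolding E_def by blast
      moreover have "it (p + k) b' ! (S b' + u) \<in> B' n" using S(2)[OF u(1)] u(2) by simp
      ultimately show False using closure_subset by blast
    qed
    with funpow_in[of i] C show False by blast
  qed
  with C show "Y = subshift \<rho>" by blast
qed (use assms in simp)

end

section \<open>Twisted ergodic averages of cylinders\<close>

lemma funpow_left_shift: "(left_shift ^^ i) x = (\<lambda>n. x (n + int i))"
  by (induction i) (auto simp: left_shift_def add_ac)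

lemma inj_on_rotate: "inj_on (\<lambda>t. nat ((n + int t) mod int N)) {..<N}"
proof (rule inj_onI)
  fix s t assume st: "s \<in> {..<N}" "t \<in> {..<N}"
    and eq: "nat ((n + int s) mod int N) = nat ((n + int t) mod int N)"
  then have "(n + int s) mod int N = (n + int t) mod int N"
    by (subst (asm) eq_nat_nat_iff) auto
  then have "(n + int s - n) mod int N = (n + int t - n) mod int N" by (rule mod_diff_cong) simp
  with st show "s = t" by simp
qed

lemma bij_betw_rotate: "bij_betw (\<lambda>i. (r + i) mod N) {..<N} {..<N :: nat}"
proof -
  have eq: "(r + i) mod N = nat ((int r + int i) mod int N)" for i
    by (metis nat_int of_nat_add zmod_int)
  have "inj_on (\<lambda>i. (r + i) mod N) {..<N}" unfolding eq by (rule inj_on_rotate)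
  moreover have "(\<lambda>i. (r + i) mod N) ` {..<N} \<subseteq> {..<N}" by auto
  ultimately show ?thesis by (simp add: bij_betw_def endo_inj_surj)
qed

lemma sum_blocks:
  fixes g :: "nat \<Rightarrow> 'a::comm_monoid_add"
  shows "(\<Sum>i<J * N. g i) = (\<Sum>j<J. \<Sum>i<N. g (i + j * N))"
proof -
  have "(\<Sum>i<N. g (i + j * N)) = sum g {j * N..<j * N + N}" for j
    using sum.shift_bounds_nat_ivl[of g 0 "j * N" N] by (simp add: lessThan_atLeast0 add.commute)
  then show ?thesis by (simp add: sum.nat_group)
qed

lemma norm_root_of_unity:
  fixes \<zeta> :: complex
  assumes "\<zeta> ^ N = 1" "N > 0"
  shows "norm \<zeta> = 1"
  using assms by (metis norm_ge_zero norm_one norm_power power_eq_1_iff neq0_conv zero_less_iff_neq_zero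
      power_eq_imp_eq_base power_one zero_le_one)

context column_substitution
begin

text \<open>The conjugate phase makes a function with eigenvalue \<zeta> of modulus one a fixed
  point of the corresponding averaging operator.\<close>

definition twisted_average :: "complex \<Rightarrow> nat \<Rightarrow> (int \<Rightarrow> 'a) set \<Rightarrow> (int \<Rightarrow> 'a) \<Rightarrow> complex" where
  "twisted_average \<zeta> k V x =
     (\<Sum>i<L ^ k. cnj \<zeta> ^ i * indicator V ((left_shift ^^ i) x)) / of_nat (L ^ k)"

text \<open>Only an object of comparison: the word \<open>it k 0\<close> repeated periodically.
  Membership in the subshift is not claimed.\<close>

definition periodic_point :: "nat \<Rightarrow> nat \<Rightarrow> int \<Rightarrow> 'a" where
  "periodic_point k t n = it k 0 ! nat ((n + int t) mod int (L ^ k))"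

definition periodic_average :: "complex \<Rightarrow> nat \<Rightarrow> (int \<Rightarrow> 'a) set \<Rightarrow> complex" where
  "periodic_average \<zeta> k V =
     (\<Sum>t<L ^ k. cnj \<zeta> ^ t * indicator V (periodic_point k t)) / of_nat (L ^ k)"

text \<open>For these residues a coordinate in the window falls on a nonconstant column, so the
  periodic point need not agree with the actual point there.\<close>

definition unresolved :: "nat \<Rightarrow> int set \<Rightarrow> nat set" where
  "unresolved k W = {t. t < L ^ k \<and> (\<exists>n\<in>W. nat ((n + int t) mod int (L ^ k)) \<in> NC k)}"

definition defect :: "nat \<Rightarrow> int set \<Rightarrow> real" where
  "defect k W = real (card W) * ((real L - 1) / real L) ^ k"

lemma defect_ratio: "norm ((real L - 1) / real L) < 1"
  using L_ge_2 by (simp add: divide_less_eq)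

lemma defect_tendsto: "(\<lambda>k. defect k W) \<longlonglongrightarrow> 0"
proof -
  have "(\<lambda>k. ((real L - 1) / real L) ^ k) \<longlonglongrightarrow> 0"
    using defect_ratio by (intro LIMSEQ_power_zero)
  from tendsto_mult_left[OF this, of "real (card W)"] show ?thesis by (simp add: defect_def)
qed

lemma finite_unresolved [simp]: "finite (unresolved k W)"
  by (simp add: unresolved_def)

text \<open>Each coordinate in \<open>W\<close> moves the residues injectively, so it is bad for at
  most \<open>card (NC k)\<close> of them.\<close>

lemma card_unresolved:
  assumes "finite W"
  shows "real (card (unresolved k W)) / real (L ^ k) \<le> defect k W"
proof -
  let ?f = "\<lambda>n t. nat ((n + int t) mod int (L ^ k))"
  have eq: "unresolved k W = (\<Union>n\<in>W. {t\<in>{..<L ^ k}. ?f n t \<in> NC k})"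
    by (auto simp: unresolved_def)
  have "card {t\<in>{..<L ^ k}. ?f n t \<in> NC k} \<le> (L - 1) ^ k" for n
  proof -
    have "card {t\<in>{..<L ^ k}. ?f n t \<in> NC k} \<le> card (NC k)"
    proof (rule card_inj_on_le)
      show "inj_on (?f n) {t\<in>{..<L ^ k}. ?f n t \<in> NC k}"
        by (rule inj_on_subset[OF inj_on_rotate]) auto
    qed auto
    then show ?thesis using card_NC[of k] by linarith
  qed
  then have "card (unresolved k W) \<le> (\<Sum>n\<in>W. (L - 1) ^ k)"
    unfolding eq by (intro order.trans[OF card_UN_le[OF assms]] sum_mono)
  then have "real (card (unresolved k W)) \<le> real (card W * (L - 1) ^ k)"
    by (subst of_nat_le_iff) simp
  also have "\<dots> = defect k W * real (L ^ k)"
    using L_ge_2 by (simp add: defect_def power_divide of_nat_diff)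
  finally show ?thesis by (simp add: divide_le_eq)
qed

lemma resolves_mod [simp]: "resolves k (r mod L ^ k) x \<longleftrightarrow> resolves k r x"
proof -
  have "(n + int (r mod L ^ k)) mod int (L ^ k) = (n + int r) mod int (L ^ k)" for n
    by (simp add: zmod_int mod_simps)
  then show ?thesis unfolding resolves_def by (simp only:)
qed

lemma resolves_shift:
  assumes "resolves k r x"
  shows "resolves k (r + i) ((left_shift ^^ i) x)"
  unfolding resolves_def funpow_left_shift
proof (intro allI impI)
  fix n
  have "n + int (r + i) = (n + int i) + int r" by simp
  then show "nat ((n + int (r + i)) mod int (L ^ k)) \<notin> NC k \<Longrightarrow>
      x (n + int i) = it k 0 ! nat ((n + int (r + i)) mod int (L ^ k))"
    using assms unfolding resolves_def by metis
qed

lemma resolves_cylinder: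
  assumes "resolves k r x" "cylinder W V" "r mod L ^ k \<notin> unresolved k W"
  shows "x \<in> V \<longleftrightarrow> periodic_point k (r mod L ^ k) \<in> V"
proof -
  have "x n = periodic_point k (r mod L ^ k) n" if "n \<in> W" for n
  proof -
    have "nat ((n + int (r mod L ^ k)) mod int (L ^ k)) \<notin> NC k"
      using assms(3) that by (auto simp: unresolved_def)
    moreover have "resolves k (r mod L ^ k) x" using assms(1) by simp
    ultimately show ?thesis unfolding resolves_def periodic_point_def by blast
  qed
  with assms(2) show ?thesis unfolding cylinder_def by blast
qed

text \<open>During \<open>L ^ k\<close> consecutive times every residue occurs exactly once,
  whatever the start.\<close>

lemma sum_unresolved_rotate:
  "(\<Sum>i<L ^ k. indicator (unresolved k W) ((r + i) mod L ^ k)) = real (card (unresolved k W))"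
proof -
  have "(\<Sum>i<L ^ k. indicator (unresolved k W) ((r + i) mod L ^ k))
      = (\<Sum>t<L ^ k. indicator (unresolved k W) t :: real)"
    by (rule sum.reindex_bij_betw[OF bij_betw_rotate])
  moreover have "{..<L ^ k} \<inter> unresolved k W = unresolved k W" by (auto simp: unresolved_def)
  ultimately show ?thesis by (simp add: indicator_def sum.If_cases)
qed

text \<open>At time \<open>i\<close> the residue is \<open>r + i\<close>. Taking it as summation
  variable in the periodic average produces the phase \<open>\<zeta> ^ r\<close>, and the two sums
  differ only at times whose residue is unresolved.\<close>

lemma twisted_average_approx:
  assumes \<zeta>: "\<zeta> ^ (L ^ k) = 1" and x: "resolves k r x" and V: "cylinder W V"
  shows "norm (twisted_average \<zeta> k V x - \<zeta> ^ r * periodic_average \<zeta> k V) \<le> defect k W"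
proof -
  let ?N = "L ^ k"
  let ?p = "\<lambda>i. (r + i) mod ?N"
  have norm: "norm \<zeta> = 1" by (rule norm_root_of_unity[OF \<zeta>]) simp
  then have unit: "\<zeta> * cnj \<zeta> = 1" by (simp add: complex_norm_square[symmetric])
  have "\<zeta> ^ r * (\<Sum>t<?N. cnj \<zeta> ^ t * indicator V (periodic_point k t)) =
      \<zeta> ^ r * (\<Sum>i<?N. cnj \<zeta> ^ ?p i * indicator V (periodic_point k (?p i)))"
    by (subst sum.reindex_bij_betw[OF bij_betw_rotate[of r ?N], symmetric]) simp
  also have "\<dots> = (\<Sum>i<?N. cnj \<zeta> ^ i * indicator V (periodic_point k (?p i)))"
  proof -
    have cnj: "cnj \<zeta> ^ ?N = 1" using \<zeta> by (metis complex_cnj_one complex_cnj_power)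
    \<comment> \<open>The phase survives reduction of the exponent because \<zeta> is a root of
      unity of order dividing \<open>L ^ k\<close>.\<close>
    have "cnj \<zeta> ^ ?p i = cnj \<zeta> ^ (r + i)" for i
    proof -
      have "cnj \<zeta> ^ (?N * ((r + i) div ?N) + ?p i) = cnj \<zeta> ^ ?p i"
        by (simp only: power_add power_mult cnj power_one mult_1)
      then show ?thesis by simp
    qed
    then have "\<zeta> ^ r * (cnj \<zeta> ^ ?p i * z) = cnj \<zeta> ^ i * z" for i z
      using unit by (simp add: power_add power_mult_distrib[symmetric] flip: mult.assoc)
    then show ?thesis unfolding sum_distrib_left by (rule sum.cong[OF refl])
  qed
  finally have eq: "\<zeta> ^ r * (\<Sum>t<?N. cnj \<zeta> ^ t * indicator V (periodic_point k t)) =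
      (\<Sum>i<?N. cnj \<zeta> ^ i * indicator V (periodic_point k (?p i)))" .
  have "norm (cnj \<zeta> ^ i * (indicator V ((left_shift ^^ i) x) - indicator V (periodic_point k (?p i))))
      \<le> indicator (unresolved k W) (?p i)" if "i < ?N" for i
  proof (cases "?p i \<in> unresolved k W")
    case False
    from resolves_cylinder[OF resolves_shift[OF x, of i] V False] show ?thesis
      by (auto simp: indicator_def)
  qed (auto simp: norm_mult norm_power norm indicator_def)
  then have "norm (\<Sum>i<?N. cnj \<zeta> ^ i *
        (indicator V ((left_shift ^^ i) x) - indicator V (periodic_point k (?p i))))
      \<le> (\<Sum>i<?N. indicator (unresolved k W) (?p i))"
    by (intro order.trans[OF norm_sum] sum_mono) auto
  also have "\<dots> = card (unresolved k W)" by (rule sum_unresolved_rotate)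
  finally have "norm (\<Sum>i<?N. cnj \<zeta> ^ i *
      (indicator V ((left_shift ^^ i) x) - indicator V (periodic_point k (?p i)))) / real ?N
      \<le> card (unresolved k W) / real ?N" by (rule divide_right_mono) simp
  also have "\<dots> \<le> defect k W" using V by (intro card_unresolved) (simp add: cylinder_def)
  finally have *: "norm (\<Sum>i<?N. cnj \<zeta> ^ i *
      (indicator V ((left_shift ^^ i) x) - indicator V (periodic_point k (?p i)))) / real ?N
      \<le> defect k W" .
  have "twisted_average \<zeta> k V x - \<zeta> ^ r * periodic_average \<zeta> k V =
      (\<Sum>i<?N. cnj \<zeta> ^ i *
        (indicator V ((left_shift ^^ i) x) - indicator V (periodic_point k (?p i)))) / of_nat ?N"
    unfolding twisted_average_def periodic_average_def times_divide_eq_right eq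
    by (simp add: right_diff_distrib sum_subtractf diff_divide_distrib)
  with * show ?thesis by (simp add: norm_divide norm_power)
qed

lemma twisted_average_bound:
  assumes "norm \<zeta> = 1"
  shows "norm (twisted_average \<zeta> k V x) \<le> 1"
proof -
  have "norm (\<Sum>i<L ^ k. cnj \<zeta> ^ i * indicator V ((left_shift ^^ i) x)) \<le> (\<Sum>i<L ^ k. 1)"
    by (intro order.trans[OF norm_sum] sum_mono)
      (auto simp: norm_mult norm_power assms indicator_def)
  then show ?thesis by (simp add: twisted_average_def norm_divide norm_power divide_le_eq)
qed

text \<open>The longer average is the mean of \<open>L\<close> averages of length
  \<open>L ^ k\<close>, started at times that are multiples of \<open>L ^ k\<close>. All of these
  have the same residue, hence are close to the same number.\<close>

lemma twisted_average_Suc: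
  assumes \<zeta>: "\<zeta> ^ (L ^ k) = 1" and V: "cylinder W V" and x: "resolves k r x"
  shows "norm (twisted_average \<zeta> (Suc k) V x - twisted_average \<zeta> k V x) \<le> 2 * defect k W"
proof -
  let ?N = "L ^ k"
  let ?y = "\<lambda>l. (left_shift ^^ (l * ?N)) x"
  have cnj: "cnj \<zeta> ^ ?N = 1" using \<zeta> by (metis complex_cnj_one complex_cnj_power)
  have "(\<Sum>i<?N. cnj \<zeta> ^ (i + l * ?N) * indicator V ((left_shift ^^ (i + l * ?N)) x)) =
      of_nat ?N * twisted_average \<zeta> k V (?y l)" for l
  proof -
    have "cnj \<zeta> ^ (i + l * ?N) = cnj \<zeta> ^ i" for i
      by (simp add: power_add power_mult mult.commute[of l] cnj)
    then show ?thesis by (simp add: twisted_average_def funpow_add)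
  qed
  then have "twisted_average \<zeta> (Suc k) V x
      = (\<Sum>l<L. of_nat ?N * twisted_average \<zeta> k V (?y l)) / of_nat (L * ?N)"
    unfolding twisted_average_def power_Suc sum_blocks by simp
  also have "\<dots> = (\<Sum>l<L. twisted_average \<zeta> k V (?y l)) / of_nat L"
    by (simp flip: sum_distrib_left)
  finally have "twisted_average \<zeta> (Suc k) V x - twisted_average \<zeta> k V x
      = (\<Sum>l<L. twisted_average \<zeta> k V (?y l) - twisted_average \<zeta> k V x) / of_nat L"
    by (simp add: sum_subtractf diff_divide_distrib)
  moreover have "norm (twisted_average \<zeta> k V (?y l) - twisted_average \<zeta> k V x) \<le> 2 * defect k W" for l
  proof -
    have "resolves k ((r + l * ?N) mod ?N) (?y l)"
      unfolding resolves_mod by (rule resolves_shift[OF x])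
    then have "resolves k r (?y l)" unfolding mod_mult_self1 resolves_mod .
    from twisted_average_approx[OF \<zeta> this V] twisted_average_approx[OF \<zeta> x V]
    show ?thesis by norm
  qed
  then have "norm (\<Sum>l<L. twisted_average \<zeta> k V (?y l) - twisted_average \<zeta> k V x)
      \<le> (\<Sum>l<L. 2 * defect k W)" by (intro order.trans[OF norm_sum] sum_mono)
  ultimately show ?thesis by (simp add: norm_divide divide_le_eq mult.commute)
qed

section \<open>Convergence of the twisted averages and properties of their limits\<close>

lemma root_power:
  fixes \<zeta> :: complex
  assumes "\<zeta> ^ (L ^ k) = 1" "k \<le> K"
  shows "\<zeta> ^ (L ^ K) = 1"
  using assms by (metis le_add_diff_inverse power_add power_mult power_one)

definition spectral_component :: "complex \<Rightarrow> (int \<Rightarrow> 'a) set \<Rightarrow> (int \<Rightarrow> 'a) \<Rightarrow> complex" where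
  "spectral_component \<zeta> V x = lim (\<lambda>k. twisted_average \<zeta> k V x)"

text \<open>Consecutive differences are dominated by a geometric series from level \<open>k\<close>
  on, where \<zeta> is a root of the required order; hence the index shift by
  \<open>k\<close>.\<close>

lemma twisted_average_tendsto:
  assumes \<zeta>: "\<zeta> ^ (L ^ k) = 1" and V: "cylinder W V" and x: "x \<in> subshift \<rho>"
  shows "(\<lambda>K. twisted_average \<zeta> K V x) \<longlonglongrightarrow> spectral_component \<zeta> V x"
proof -
  let ?a = "\<lambda>K. twisted_average \<zeta> K V x"
  have "norm (?a (Suc (K + k)) - ?a (K + k)) \<le> 2 * defect (K + k) W" for K
  proof -
    obtain r where "resolves (K + k) r x" using ex_resolves[OF x] .
    with twisted_average_Suc[OF root_power[OF \<zeta>] V] show ?thesis by simp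
  qed
  moreover have "summable (\<lambda>K. 2 * defect (K + k) W)"
    unfolding defect_def using defect_ratio
    by (auto simp: power_add intro!: summable_mult summable_mult2 summable_geometric)
  ultimately have "summable (\<lambda>K. ?a (Suc (K + k)) - ?a (K + k))"
    by (rule summable_comparison_test'[rotated, where N = 0])
  then have "convergent (\<lambda>n. \<Sum>K<n. ?a (Suc (K + k)) - ?a (K + k))"
    by (simp add: summable_iff_convergent)
  moreover have "(\<Sum>K<n. ?a (Suc (K + k)) - ?a (K + k)) = ?a (n + k) - ?a k" for n
    using sum_lessThan_telescope[of "\<lambda>K. ?a (K + k)" n] by simp
  ultimately have "convergent (\<lambda>n. ?a (n + k) - ?a k)" by simp
  then have "convergent ?a"
    using convergent_diff_const_right_iff[of "\<lambda>n. ?a (n + k)" "?a k"]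
      convergent_ignore_initial_segment[of ?a k] by blast
  then show ?thesis unfolding spectral_component_def by (simp add: convergent_LIMSEQ_iff)
qed

text \<open>After adjusting the phase, shifting the point changes the average only by two boundary
  terms, of total size at most \<open>2 / L ^ K\<close>.\<close>

lemma spectral_component_shift:
  assumes \<zeta>: "\<zeta> ^ (L ^ k) = 1" and V: "cylinder W V" and x: "x \<in> subshift \<rho>"
  shows "spectral_component \<zeta> V (left_shift x) = \<zeta> * spectral_component \<zeta> V x"
proof -
  have norm: "norm \<zeta> = 1" by (rule norm_root_of_unity[OF \<zeta>]) simp
  then have unit: "\<zeta> * cnj \<zeta> = 1" by (simp add: complex_norm_square[symmetric])
  let ?d = "\<lambda>K. twisted_average \<zeta> K V (left_shift x) - \<zeta> * twisted_average \<zeta> K V x"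
  have "\<forall>K. norm (?d K) \<le> 2 * (1 / real L) ^ K"
  proof
    fix K
    define f where "f i = cnj \<zeta> ^ i * (indicator V ((left_shift ^^ i) x) :: complex)" for i
    have "\<zeta> * f (Suc i) = cnj \<zeta> ^ i * indicator V ((left_shift ^^ i) (left_shift x))" for i
    proof -
      have "\<zeta> * f (Suc i) =
          (\<zeta> * cnj \<zeta>) * (cnj \<zeta> ^ i * indicator V ((left_shift ^^ i) (left_shift x)))"
        by (simp only: f_def power_Suc funpow_Suc_right o_apply mult.assoc)
      then show ?thesis by (simp only: unit mult_1)
    qed
    then have "twisted_average \<zeta> K V (left_shift x) = \<zeta> * (\<Sum>i<L ^ K. f (Suc i)) / of_nat (L ^ K)"
      by (simp only: twisted_average_def sum_distrib_left)
    moreover have "twisted_average \<zeta> K V x = (\<Sum>i<L ^ K. f i) / of_nat (L ^ K)"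
      by (simp only: twisted_average_def f_def)
    ultimately have "?d K = \<zeta> * (\<Sum>i<L ^ K. f (Suc i) - f i) / of_nat (L ^ K)"
      by (simp only: sum_subtractf right_diff_distrib diff_divide_distrib times_divide_eq_right)
    also have "\<dots> = \<zeta> * (f (L ^ K) - f 0) / of_nat (L ^ K)"
      by (simp only: sum_lessThan_telescope)
    finally have "norm (?d K) = norm (f (L ^ K) - f 0) / real (L ^ K)"
      by (simp add: norm_mult norm_divide norm norm_power)
    also have "\<dots> \<le> 2 / real (L ^ K)"
    proof (rule divide_right_mono)
      have "norm (f i) \<le> 1" for i by (simp add: f_def norm_mult norm_power norm indicator_def)
      from this[of "L ^ K"] this[of 0] show "norm (f (L ^ K) - f 0) \<le> 2" by norm
    qed simp
    finally show "norm (?d K) \<le> 2 * (1 / real L) ^ K" by (simp add: power_divide)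
  qed
  moreover have "(\<lambda>K. 2 * (1 / real L) ^ K) \<longlonglongrightarrow> 0"
    using L_ge_2 by (intro tendsto_mult_right_zero LIMSEQ_power_zero) simp
  ultimately have "?d \<longlonglongrightarrow> 0"
    by (rule Lim_null_comparison[OF always_eventually])
  moreover have "?d \<longlonglongrightarrow> spectral_component \<zeta> V (left_shift x) - \<zeta> * spectral_component \<zeta> V x"
    by (intro tendsto_intros twisted_average_tendsto[OF \<zeta> V] x left_shift_subshift)
  ultimately show ?thesis using LIMSEQ_unique by fastforce
qed

lemma ex_resolves_seq:
  assumes "x \<in> subshift \<rho>"
  obtains r where "\<And>k. resolves k (r k) x"
proof -
  have "\<exists>r. resolves k r x" for k using ex_resolves[OF assms, of k] by blast
  then show thesis using that by metis
qed

text \<open>Separates the dependence on the point, a phase, from numbers common to all points; this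
  makes components at different points comparable.\<close>

lemma spectral_component_approx:
  assumes \<zeta>: "\<zeta> ^ (L ^ k) = 1" and V: "cylinder W V" and x: "x \<in> subshift \<rho>"
    and r: "\<And>K. resolves K (r K) x"
  shows "(\<lambda>K. \<zeta> ^ r K * periodic_average \<zeta> K V) \<longlonglongrightarrow> spectral_component \<zeta> V x"
proof -
  let ?d = "\<lambda>K. twisted_average \<zeta> K V x - \<zeta> ^ r K * periodic_average \<zeta> K V"
  have "\<forall>\<^sub>F K in sequentially. norm (?d K) \<le> defect K W"
    using twisted_average_approx[OF root_power[OF \<zeta>] r V]
    by (auto intro: eventually_sequentiallyI[of k])
  then have "?d \<longlonglongrightarrow> 0" using defect_tendsto by (rule Lim_null_comparison)
  from tendsto_diff[OF twisted_average_tendsto[OF \<zeta> V x] this] show ?thesis by simp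
qed

text \<open>Only phases of modulus one depend on the point. In particular a component vanishes
  everywhere on the subshift or nowhere.\<close>

lemma spectral_component_norm_eq:
  assumes \<zeta>: "\<zeta> ^ (L ^ k) = 1" and V: "cylinder W V" and xy: "x \<in> subshift \<rho>" "y \<in> subshift \<rho>"
  shows "norm (spectral_component \<zeta> V x) = norm (spectral_component \<zeta> V y)"
proof -
  have norm: "norm \<zeta> = 1" by (rule norm_root_of_unity[OF \<zeta>]) simp
  have "(\<lambda>K. norm (periodic_average \<zeta> K V)) \<longlonglongrightarrow> norm (spectral_component \<zeta> V z)"
    if z: "z \<in> subshift \<rho>" for z
  proof -
    obtain r where "\<And>k. resolves k (r k) z" using ex_resolves_seq[OF z] by blast
    from tendsto_norm[OF spectral_component_approx[OF \<zeta> V z this]] show ?thesis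
      by (simp add: norm_mult norm_power norm)
  qed
  from LIMSEQ_unique[OF this this] xy show ?thesis by blast
qed

text \<open>The components to a given eigenvalue are proportional: both sides are limits of
  \<open>\<zeta> ^ (r + s)\<close> times the same product of periodic averages.\<close>

lemma spectral_component_proportional:
  assumes \<zeta>: "\<zeta> ^ (L ^ k) = 1" and V: "cylinder W V" "cylinder W' V'"
    and xy: "x \<in> subshift \<rho>" "y \<in> subshift \<rho>"
  shows "spectral_component \<zeta> V x * spectral_component \<zeta> V' y
       = spectral_component \<zeta> V y * spectral_component \<zeta> V' x"
proof -
  obtain r where r: "\<And>k. resolves k (r k) x" using ex_resolves_seq[OF xy(1)] by blast
  obtain s where s: "\<And>k. resolves k (s k) y" using ex_resolves_seq[OF xy(2)] by blast
  note lim = spectral_component_approx[OF \<zeta>]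
  from tendsto_mult[OF lim[OF V(1) xy(1) r] lim[OF V(2) xy(2) s]]
    tendsto_mult[OF lim[OF V(1) xy(2) s] lim[OF V(2) xy(1) r]]
  show ?thesis by (simp add: mult_ac LIMSEQ_unique)
qed

end

section \<open>Uniqueness of the invariant measure\<close>

lemma restrict_borel_eq_sigma:
  "sets (restrict_space borel X) = sigma_sets X {U \<inter> X | U. open U}"
proof -
  have "sigma_sets X {(\<lambda>x. x) -` U \<inter> X | U. U \<in> {U. open U}}
      = {(\<lambda>x. x) -` A \<inter> X | A. A \<in> sigma_sets UNIV {U. open U}}"
    by (rule sigma_sets_vimage_commute[symmetric]) auto
  also have "\<dots> = sets (restrict_space borel X)"
    by (auto simp: sets_restrict_space borel_def)
  finally show ?thesis by (simp add: vimage_def)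
qed

lemma open_Int_in_sets:
  assumes "sets M = sets (restrict_space borel X)" "open U"
  shows "U \<inter> X \<in> sets M"
  unfolding assms(1) restrict_borel_eq_sigma using assms(2) by (intro sigma_sets.Basic) blast

text \<open>Inner regularity reduces the open set to compact subsets, and a cylinder fits between
  such a compact set and the open set.\<close>

lemma regular_measure_le:
  fixes X :: "(int \<Rightarrow> 'a::t2_space) set"
  assumes M: "regular_borel_prob X M" and N: "regular_borel_prob X N"
    and cyl: "\<And>W V. cylinder W V \<Longrightarrow> emeasure M (V \<inter> X) = emeasure N (V \<inter> X)"
    and U: "open U"
  shows "emeasure M (U \<inter> X) \<le> emeasure N (U \<inter> X)"
proof -
  have sets: "sets M = sets (restrict_space borel X)" "sets N = sets (restrict_space borel X)"
    using M N by (simp_all add: regular_borel_prob_def)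
  have "emeasure M (U \<inter> X) = (SUP K\<in>{K. compact K \<and> K \<subseteq> U \<inter> X}. emeasure M K)"
    using M open_Int_in_sets[OF sets(1) U] by (simp add: regular_borel_prob_def)
  also have "\<dots> \<le> emeasure N (U \<inter> X)"
  proof (rule SUP_least)
    fix K assume "K \<in> {K. compact K \<and> K \<subseteq> U \<inter> X}"
    then have K: "compact K" "K \<subseteq> U" "K \<subseteq> X" by auto
    obtain W V where V: "cylinder W V" "K \<subseteq> V" "V \<subseteq> U"
      using compact_subset_cylinder[OF K(1) U K(2)] .
    then have "open V" by (simp add: cylinder_def)
    then have "emeasure M K \<le> emeasure M (V \<inter> X)"
      using V K open_Int_in_sets[OF sets(1)] by (intro emeasure_mono) auto
    also have "\<dots> = emeasure N (V \<inter> X)" by (rule cyl[OF V(1)])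
    also have "\<dots> \<le> emeasure N (U \<inter> X)"
      using V open_Int_in_sets[OF sets(2) U] by (intro emeasure_mono) auto
    finally show "emeasure M K \<le> emeasure N (U \<inter> X)" .
  qed
  finally show ?thesis .
qed

text \<open>The relatively open sets form an intersection-stable generator, and on them the previous
  inequality holds in both directions.\<close>

lemma regular_measure_eqI:
  fixes X :: "(int \<Rightarrow> 'a::t2_space) set"
  assumes M: "regular_borel_prob X M" and N: "regular_borel_prob X N"
    and cyl: "\<And>W V. cylinder W V \<Longrightarrow> emeasure M (V \<inter> X) = emeasure N (V \<inter> X)"
  shows "M = N"
proof (rule measure_eqI_generator_eq)
  interpret prob_space M using M by (simp add: regular_borel_prob_def)
  show "Int_stable {U \<inter> X | U. open U}"
  proof (rule Int_stableI)
    fix A B assume "A \<in> {U \<inter> X | U. open U}" "B \<in> {U \<inter> X | U. open U}"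
    then obtain U V where "A = U \<inter> X" "open U" "B = V \<inter> X" "open V" by blast
    then show "A \<inter> B \<in> {U \<inter> X | U. open U}"
      by (intro CollectI exI[of _ "U \<inter> V"]) auto
  qed
  show "{U \<inter> X | U. open U} \<subseteq> Pow X" by blast
  show "emeasure M A = emeasure N A" if A: "A \<in> {U \<inter> X | U. open U}" for A
  proof -
    from A obtain U where U: "A = U \<inter> X" "open U" by blast
    show ?thesis
      unfolding U(1) using regular_measure_le[OF M N cyl U(2)] regular_measure_le[OF N M cyl[symmetric] U(2)]
      by (rule antisym)
  qed
  show "sets M = sigma_sets X {U \<inter> X | U. open U}" "sets N = sigma_sets X {U \<inter> X | U. open U}"
    using M N by (simp_all add: regular_borel_prob_def restrict_borel_eq_sigma)
  show "range (\<lambda>_::nat. X) \<subseteq> {U \<inter> X | U. open U}" using open_UNIV by blast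
  show "emeasure M X \<noteq> \<infinity>" by simp
qed auto

lemma continuous_left_shift: "continuous_on S (left_shift :: (int \<Rightarrow> 'a::topological_space) \<Rightarrow> _)"
  unfolding left_shift_def
  by (intro continuous_on_coordinatewise_then_product continuous_on_subset[OF continuous_on_product_coordinates]) simp

context column_substitution
begin

abbreviation "X \<equiv> subshift \<rho>"

lemma measurable_left_shift: "left_shift \<in> measurable (restrict_space borel X) (restrict_space borel X)"
proof (rule measurable_restrict_space2)
  show "left_shift \<in> space (restrict_space borel X) \<rightarrow> X"
    by (auto simp: space_restrict_space left_shift_subshift)
  show "left_shift \<in> restrict_space borel X \<rightarrow>\<^sub>M borel"
    by (rule borel_measurable_continuous_on_restrict[OF continuous_left_shift])
qed

end

locale invariant_measure = column_substitution +
  fixes M :: "(int \<Rightarrow> 'a) measure"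
  assumes invariant: "invariant_prob X left_shift M"
begin

lemma regular_M: "regular_borel_prob X M"
  and measurable_shift [measurable]: "left_shift \<in> measurable M M"
  and distr_shift: "distr M M left_shift = M"
  using invariant by (simp_all add: invariant_prob_def)

sublocale prob_space M
  using regular_M by (simp add: regular_borel_prob_def)

lemma space_M [simp]: "space M = X" and sets_M: "sets M = sets (restrict_space borel X)"
  using regular_M by (simp_all add: regular_borel_prob_def)

lemma cylinder_Int_sets: "cylinder W V \<Longrightarrow> V \<inter> X \<in> sets M"
  by (rule open_Int_in_sets[OF sets_M]) (simp add: cylinder_def)

lemma measurable_indicator_cylinder:
  assumes "cylinder W V"
  shows "(indicator V :: _ \<Rightarrow> complex) \<in> borel_measurable M"
  using cylinder_Int_sets[OF assms] by (simp add: borel_measurable_indicator_iff)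

lemma measurable_funpow_shift [measurable]: "left_shift ^^ i \<in> measurable M M"
  by (induction i) (auto intro: measurable_comp measurable_shift)

lemma integral_shift:
  fixes f :: "(int \<Rightarrow> 'a) \<Rightarrow> complex"
  assumes [measurable]: "f \<in> borel_measurable M"
  shows "(LINT x|M. f (left_shift x)) = (LINT x|M. f x)"
  using integral_distr[of left_shift M M f] by (simp add: distr_shift)

lemma integral_funpow_shift:
  fixes f :: "(int \<Rightarrow> 'a) \<Rightarrow> complex"
  assumes [measurable]: "f \<in> borel_measurable M"
  shows "(LINT x|M. f ((left_shift ^^ i) x)) = (LINT x|M. f x)"
proof (induction i)
  case (Suc i)
  have "(\<lambda>x. f ((left_shift ^^ i) x)) \<in> borel_measurable M" by measurable
  from integral_shift[OF this] Suc show ?case by (simp add: funpow_Suc_right del: funpow.simps)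
qed simp

lemma measurable_twisted_average [measurable]:
  assumes "cylinder W V"
  shows "twisted_average \<zeta> k V \<in> borel_measurable M"
  unfolding twisted_average_def
  by (intro borel_measurable_divide borel_measurable_sum borel_measurable_times
      borel_measurable_const measurable_compose[OF measurable_funpow_shift]
      measurable_indicator_cylinder[OF assms])

lemma integrable_bounded:
  fixes f :: "(int \<Rightarrow> 'a) \<Rightarrow> complex"
  assumes "f \<in> borel_measurable M" "\<And>x. x \<in> X \<Longrightarrow> norm (f x) \<le> c"
  shows "integrable M f"
  by (rule integrable_const_bound[of _ c]) (use assms in auto)

lemma integral_indicator_cylinder:
  assumes "cylinder W V"
  shows "(LINT x|M. indicator V x) = complex_of_real (measure M (V \<inter> X))"
proof -
  have "(LINT x|M. indicator V x) = (LINT x|M. complex_of_real (indicator V x))"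
    by (rule Bochner_Integration.integral_cong) (auto simp: indicator_def)
  then show ?thesis by simp
qed

text \<open>By invariance the measure is the integral of the average at \<zeta> = 1, which is
  uniformly close to a number in which \<open>M\<close> does not occur.\<close>

lemma measure_cylinder_approx:
  assumes V: "cylinder W V"
  shows "norm (complex_of_real (measure M (V \<inter> X)) - periodic_average 1 k V) \<le> defect k W"
proof -
  note [measurable] = measurable_indicator_cylinder[OF V]
  have int: "integrable M (\<lambda>x. indicator V ((left_shift ^^ i) x) :: complex)" for i
    by (rule integrable_bounded[of _ 1, OF measurable_compose[OF measurable_funpow_shift
        measurable_indicator_cylinder[OF V]]]) (simp add: indicator_def)
  have int_avg: "integrable M (twisted_average 1 k V)"
    by (rule integrable_bounded[of _ 1]) (use V twisted_average_bound in auto)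
  have "(LINT x|M. twisted_average 1 k V x) = complex_of_real (measure M (V \<inter> X))"
    using int by (simp add: twisted_average_def integral_funpow_shift integral_indicator_cylinder[OF V])
  then have "complex_of_real (measure M (V \<inter> X)) - periodic_average 1 k V
      = (LINT x|M. twisted_average 1 k V x - periodic_average 1 k V)"
    using int_avg by (simp add: prob_space[unfolded space_M])
  also have "norm \<dots> \<le> (LINT x|M. norm (twisted_average 1 k V x - periodic_average 1 k V))"
    by (rule integral_norm_bound)
  also have "\<dots> \<le> (LINT x|M. defect k W)"
  proof (rule integral_mono)
    fix x assume "x \<in> space M"
    then have x: "x \<in> X" by simp
    obtain r where "resolves k r x" using ex_resolves[OF x] .
    from twisted_average_approx[OF _ this V, of 1]
    show "norm (twisted_average 1 k V x - periodic_average 1 k V) \<le> defect k W" by simp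
  qed (use int_avg in auto)
  finally show ?thesis by (simp add: prob_space[unfolded space_M])
qed

end

context column_substitution
begin

text \<open>Serves twice: for two invariant measures, and for the constructed measure against its
  image under the shift.\<close>

lemma regular_measures_eq:
  assumes "regular_borel_prob X M" "regular_borel_prob X N"
    and "\<And>W V k. cylinder W V \<Longrightarrow>
      norm (complex_of_real (measure M (V \<inter> X)) - periodic_average 1 k V) \<le> a k W"
    and "\<And>W V k. cylinder W V \<Longrightarrow>
      norm (complex_of_real (measure N (V \<inter> X)) - periodic_average 1 k V) \<le> b k W"
    and "\<And>W. (\<lambda>k. a k W) \<longlonglongrightarrow> 0" "\<And>W. (\<lambda>k. b k W) \<longlonglongrightarrow> 0"
  shows "M = N"
proof (rule regular_measure_eqI[OF assms(1,2)])
  fix W and V :: "(int \<Rightarrow> 'a) set" assume V: "cylinder W V"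
  interpret M: prob_space M using assms(1) by (simp add: regular_borel_prob_def)
  interpret N: prob_space N using assms(2) by (simp add: regular_borel_prob_def)
  let ?m = "complex_of_real (measure M (V \<inter> X))" and ?n = "complex_of_real (measure N (V \<inter> X))"
  have "norm (?m - ?n) \<le> a k W + b k W" for k
    using assms(3,4)[OF V, of k] by norm
  moreover have "(\<lambda>k. a k W + b k W) \<longlonglongrightarrow> 0"
    using tendsto_add[OF assms(5,6)] by simp
  ultimately have "norm (?m - ?n) \<le> 0" by (intro LIMSEQ_le_const) auto
  then show "emeasure M (V \<inter> X) = emeasure N (V \<inter> X)"
    by (simp add: M.emeasure_eq_measure N.emeasure_eq_measure)
qed

lemma invariant_measure_unique:
  assumes "invariant_prob X left_shift M" "invariant_prob X left_shift N"
  shows "M = N"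
proof -
  interpret M: invariant_measure \<rho> L M by unfold_locales (rule assms(1))
  interpret N: invariant_measure \<rho> L N by unfold_locales (rule assms(2))
  show ?thesis
    by (rule regular_measures_eq[OF M.regular_M N.regular_M
        M.measure_cylinder_approx N.measure_cylinder_approx defect_tendsto defect_tendsto])
qed

end

section \<open>Existence of the invariant measure\<close>

lemma compact_imp_closed_fun:
  fixes K :: "('i \<Rightarrow> 'a::t2_space) set"
  assumes "compact K"
  shows "closed K"
proof -
  have "Hausdorff_space (euclidean :: 'a topology)"
    by (simp add: Hausdorff_space_def separation_t2 disjnt_def)
  then have "Hausdorff_space (product_topology (\<lambda>_::'i. euclidean :: 'a topology) UNIV)"
    by (simp add: Hausdorff_space_product_topology del: euclidean_product_topology)
  then have "Hausdorff_space (euclidean :: ('i \<Rightarrow> 'a) topology)"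
    by (simp only: euclidean_product_topology)
  then have "closedin euclidean K" by (rule compactin_imp_closedin) (use assms in simp)
  then show ?thesis by simp
qed

text \<open>On a Polish space finite Borel measures are inner regular. Compact subsets of
  \<open>G\<close> have compact images because \<Psi> is continuous there, and \<open>G\<close>
  carries full measure; the constant value off \<open>G\<close> secures measurability.\<close>

lemma regular_distr:
  fixes P :: "'b::polish_space measure" and \<Psi> :: "'b \<Rightarrow> 'i \<Rightarrow> 'x::t2_space"
  assumes P: "prob_space P" and sets_P: "sets P = sets borel"
    and G: "G \<in> sets borel" "AE \<omega> in P. \<omega> \<in> G"
    and cont: "continuous_on G \<Psi>" and const: "\<And>\<omega>. \<omega> \<notin> G \<Longrightarrow> \<Psi> \<omega> = c"
    and range: "\<And>\<omega>. \<Psi> \<omega> \<in> X"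
  shows "\<Psi> \<in> measurable P (restrict_space borel X)"
    and "regular_borel_prob X (distr P (restrict_space borel X) \<Psi>)"
proof -
  interpret P: prob_space P by fact
  have space_P: "space P = UNIV" using sets_eq_imp_space_eq[OF sets_P] by simp
  have "(\<lambda>\<omega>. if \<omega> \<in> G then \<Psi> \<omega> else c) \<in> borel_measurable borel"
    by (rule borel_measurable_continuous_on_if[OF G(1) cont continuous_on_const])
  also have "(\<lambda>\<omega>. if \<omega> \<in> G then \<Psi> \<omega> else c) = \<Psi>" using const by auto
  finally have "\<Psi> \<in> measurable P borel" by (simp add: measurable_cong_sets[OF sets_P])
  then show meas: "\<Psi> \<in> measurable P (restrict_space borel X)"
    by (intro measurable_restrict_space2) (use range in auto)
  let ?M = "distr P (restrict_space borel X) \<Psi>"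
  show "regular_borel_prob X ?M"
    unfolding regular_borel_prob_def
  proof (intro conjI ballI)
    show "prob_space ?M" by (rule P.prob_space_distr[OF meas])
    show "space ?M = X" "sets ?M = sets (restrict_space borel X)" by (simp_all add: space_restrict_space)
    fix E assume E: "E \<in> sets ?M"
    have compact_sets: "K \<in> sets (restrict_space borel X)" if "compact K" "K \<subseteq> X" for K
      using that by (auto simp: sets_restrict_space compact_imp_closed_fun intro!: image_eqI[of _ _ K])
    have E_X: "E \<subseteq> X" using sets.sets_into_space[OF E] by (simp add: space_restrict_space)
    have vimage: "\<Psi> -` E \<in> sets P" using measurable_sets[OF meas, of E] E by (simp add: space_P)
    then have EG: "\<Psi> -` E \<inter> G \<in> sets borel" using G by (auto simp: sets_P)
    have "emeasure ?M E = emeasure P (\<Psi> -` E)" using E by (simp add: emeasure_distr[OF meas] space_P)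
    also have "\<dots> = emeasure P (\<Psi> -` E \<inter> G)"
      by (rule emeasure_eq_AE) (use G(2) vimage EG in \<open>auto simp: sets_P\<close>)
    also have "\<dots> = (SUP K\<in>{K. K \<subseteq> \<Psi> -` E \<inter> G \<and> compact K}. emeasure P K)"
      by (rule inner_regular[OF sets_P _ EG]) simp
    also have "\<dots> \<le> (SUP K\<in>{K. compact K \<and> K \<subseteq> E}. emeasure ?M K)"
    proof (rule SUP_mono)
      fix K assume "K \<in> {K. K \<subseteq> \<Psi> -` E \<inter> G \<and> compact K}"
      then have K: "K \<subseteq> \<Psi> -` E" "K \<subseteq> G" "compact K" by auto
      have cpt: "compact (\<Psi> ` K)"
        by (rule compact_continuous_image[OF continuous_on_subset[OF cont K(2)] K(3)])
      have sub: "\<Psi> ` K \<subseteq> E" using K(1) by auto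
      have "\<Psi> ` K \<in> sets (restrict_space borel X)"
        by (rule compact_sets[OF cpt]) (use sub E_X in auto)
      then have "emeasure ?M (\<Psi> ` K) = emeasure P (\<Psi> -` \<Psi> ` K)" "\<Psi> -` \<Psi> ` K \<in> sets P"
        using measurable_sets[OF meas, of "\<Psi> ` K"] by (simp_all add: emeasure_distr[OF meas] space_P)
      then have "emeasure P K \<le> emeasure ?M (\<Psi> ` K)"
        by (simp add: emeasure_mono subset_vimage_iff)
      with cpt sub show "\<exists>K'\<in>{K. compact K \<and> K \<subseteq> E}. emeasure P K \<le> emeasure ?M K'" by blast
    qed
    finally show "emeasure ?M E = (SUP K\<in>{K. compact K \<and> K \<subseteq> E}. emeasure ?M K)"
      using E by (intro antisym SUP_least emeasure_mono) auto
  qed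
qed

context column_substitution
begin

section \<open>The Haar measure on the \<open>L\<close>-adic integers in terms of digits\<close>

definition digit_measure :: "(nat \<Rightarrow> nat discrete) measure" where
  "digit_measure = (\<Pi>\<^sub>M _\<in>UNIV. measure_pmf (map_pmf discrete (pmf_of_set {..<L})))"

text \<open>The digits are reduced modulo \<open>L\<close> so that every sequence is an \<open>L\<close>-adic integer. They have
  type \<^typ>\<open>nat discrete\<close> because \<^typ>\<open>nat\<close> is not an instance of \<^class>\<open>polish_space\<close>.\<close>

definition residue :: "nat \<Rightarrow> (nat \<Rightarrow> nat discrete) \<Rightarrow> nat" where
  "residue k \<omega> = (\<Sum>i<k. (of_discrete (\<omega> i) mod L) * L ^ i)"

lemma sets_digit_measure: "sets digit_measure = sets borel"
proof -
  have "sets digit_measure = sets (\<Pi>\<^sub>M _\<in>(UNIV::nat set). (borel :: nat discrete measure))"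
    unfolding digit_measure_def by (rule sets_PiM_cong) (auto simp: sets_borel_eq_count_space)
  then show ?thesis by (simp add: sets_PiM_equal_borel)
qed

lemma space_digit_measure [simp]: "space digit_measure = UNIV"
  by (simp add: digit_measure_def space_PiM)

sublocale D: product_prob_space "\<lambda>_::nat. measure_pmf (map_pmf discrete (pmf_of_set {..<L}))" UNIV
  by unfold_locales

sublocale D: prob_space digit_measure
  unfolding digit_measure_def by (rule D.P.prob_space_axioms)

lemma residue_Suc: "residue (Suc k) \<omega> = residue k \<omega> + (of_discrete (\<omega> k) mod L) * L ^ k"
  by (simp add: residue_def)

lemma residue_less: "residue k \<omega> < L ^ k"
proof (induction k)
  case (Suc k)
  have "(of_discrete (\<omega> k) mod L + 1) * L ^ k \<le> L * L ^ k" by (intro mult_right_mono) (auto simp: Suc_leI)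
  with Suc show ?case by (simp add: residue_Suc)
qed (simp add: residue_def)

lemma residue_mod:
  assumes "k \<le> K"
  shows "residue K \<omega> mod L ^ k = residue k \<omega>"
  using assms
proof (induction K rule: dec_induct)
  case base
  then show ?case by (simp add: residue_less)
next
  case (step K)
  then have "L ^ K = L ^ (K - k) * L ^ k" by (simp flip: power_add)
  with step show ?case by (simp add: residue_Suc mult.assoc[symmetric])
qed

lemma residue_digits: "residue k (\<lambda>i. discrete (t div L ^ i)) = t mod L ^ k"
proof (induction k)
  case (Suc k)
  then show ?case using mod_mult2_eq[of t "L ^ k" L] by (simp add: residue_Suc mult.commute discrete_inverse)
qed (simp add: residue_def)

lemma open_residue: "open {\<omega>. Q (residue k \<omega>)}"
proof (rule Topological_Spaces.openI)
  fix \<omega> assume \<omega>: "\<omega> \<in> {\<omega>. Q (residue k \<omega>)}"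
  let ?T = "{\<omega>'. \<forall>i\<in>{..<k}. \<omega>' i \<in> {\<omega> i}}"
  have "open ?T"
    using product_topology_basis'[where I = "{..<k}" and x = "\<lambda>i. i" and U = "\<lambda>i. {\<omega> i}",
      OF finite_lessThan open_discrete] .
  moreover have "?T \<subseteq> {\<omega>. Q (residue k \<omega>)}"
  proof
    fix \<omega>' assume "\<omega>' \<in> ?T"
    then have "residue k \<omega>' = residue k \<omega>" by (simp add: residue_def)
    with \<omega> show "\<omega>' \<in> {\<omega>. Q (residue k \<omega>)}" by simp
  qed
  moreover have "\<omega> \<in> ?T" by simp
  ultimately show "\<exists>T. open T \<and> \<omega> \<in> T \<and> T \<subseteq> {\<omega>. Q (residue k \<omega>)}" by meson
qed

lemma residue_sets [measurable]: "{\<omega>. Q (residue k \<omega>)} \<in> sets digit_measure"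
  unfolding sets_digit_measure by (rule borel_open[OF open_residue])

text \<open>Prescribing the first \<open>k\<close> digits bounds every residue probability from
  below by \<open>1 / L ^ k\<close>. These bounds already sum to one, so all of them are
  equalities.\<close>

lemma prob_residue_eq:
  assumes "t < L ^ k"
  shows "measure digit_measure {\<omega>. residue k \<omega> = t} = 1 / real (L ^ k)"
proof -
  have lower: "1 / real (L ^ k) \<le> measure digit_measure {\<omega>. residue k \<omega> = s}" if s: "s < L ^ k" for s
  proof -
    let ?C = "{\<omega> \<in> space digit_measure. \<forall>i\<in>{..<k}. \<omega> i \<in> {discrete (s div L ^ i mod L)}}"
    have digit: "emeasure (measure_pmf (map_pmf discrete (pmf_of_set {..<L}))) {discrete d} = ennreal (1 / real L)" if "d < L" for d
    proof -
      have "discrete -` {discrete d} = {d}" by (auto simp: discrete_inject)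
      then have "emeasure (measure_pmf (map_pmf discrete (pmf_of_set {..<L}))) {discrete d}
          = emeasure (measure_pmf (pmf_of_set {..<L})) {d}" by (simp only: emeasure_map_pmf)
      then show ?thesis
        using that L_pos by (simp add: emeasure_pmf_single pmf_of_set lessThan_empty_iff)
    qed
    have "emeasure digit_measure ?C
        = (\<Prod>i\<in>{..<k}. emeasure (measure_pmf (map_pmf discrete (pmf_of_set {..<L}))) {discrete (s div L ^ i mod L)})"
      unfolding digit_measure_def by (rule D.emeasure_PiM_Collect) auto
    also have "\<dots> = ennreal (1 / real (L ^ k))"
      by (simp add: digit ennreal_power power_one_over del: emeasure_map_pmf)
    finally have "measure digit_measure ?C = 1 / real (L ^ k)"
      by (simp add: measure_def)
    moreover
    have "?C \<subseteq> {\<omega>. residue k \<omega> = s}"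
    proof
      fix \<omega> assume "\<omega> \<in> ?C"
      then have "residue k \<omega> = residue k (\<lambda>i. discrete (s div L ^ i))" by (simp add: residue_def discrete_inverse)
      with s show "\<omega> \<in> {\<omega>. residue k \<omega> = s}" by (simp add: residue_digits)
    qed
    then have "measure digit_measure ?C \<le> measure digit_measure {\<omega>. residue k \<omega> = s}"
      by (rule D.finite_measure_mono[OF _ residue_sets])
    ultimately show ?thesis by linarith
  qed
  have "(\<Sum>s<L ^ k. measure digit_measure {\<omega>. residue k \<omega> = s})
      = measure digit_measure (\<Union>s<L ^ k. {\<omega>. residue k \<omega> = s})"
    by (rule D.finite_measure_finite_Union[symmetric]) (auto simp: disjoint_family_on_def)
  also have "(\<Union>s<L ^ k. {\<omega>. residue k \<omega> = s}) = space digit_measure"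
    using residue_less by auto
  finally have "(\<Sum>s<L ^ k. 1 / real (L ^ k)) = (\<Sum>s<L ^ k. measure digit_measure {\<omega>. residue k \<omega> = s})"
    by (simp add: D.prob_space[unfolded space_digit_measure])
  from sum_mono_inv[OF this lower, of t] assms show ?thesis by simp
qed

lemma prob_residue:
  assumes "S \<subseteq> {..<L ^ k}"
  shows "measure digit_measure {\<omega>. residue k \<omega> \<in> S} = card S / real (L ^ k)"
proof -
  have S: "finite S" using assms finite_subset by blast
  have "{\<omega>. residue k \<omega> \<in> S} = (\<Union>s\<in>S. {\<omega>. residue k \<omega> = s})" by auto
  also have "measure digit_measure \<dots> = (\<Sum>s\<in>S. measure digit_measure {\<omega>. residue k \<omega> = s})"
    by (rule D.finite_measure_finite_Union[OF S]) (auto simp: disjoint_family_on_def)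
  also have "\<dots> = (\<Sum>s\<in>S. 1 / real (L ^ k))"
    using assms by (intro sum.cong prob_residue_eq) auto
  finally show ?thesis by simp
qed

text \<open>The offset \<open>i\<close> accommodates shifted copies of the coding map.\<close>

lemma prob_residue_rotate:
  assumes "S \<subseteq> {..<L ^ k}"
  shows "measure digit_measure {\<omega>. (i + residue k \<omega>) mod L ^ k \<in> S} = card S / real (L ^ k)"
proof -
  let ?f = "\<lambda>t. (i + t) mod L ^ k"
  define S' where "S' = {t\<in>{..<L ^ k}. ?f t \<in> S}"
  have bij: "bij_betw ?f {..<L ^ k} {..<L ^ k}" by (rule bij_betw_rotate)
  have "?f ` S' = ?f ` {..<L ^ k} \<inter> S" unfolding S'_def by blast
  also have "\<dots> = S" using bij assms by (auto simp: bij_betw_def)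
  finally have "?f ` S' = S" .
  moreover have "inj_on ?f S'" using bij unfolding bij_betw_def S'_def by (auto intro: inj_on_subset)
  ultimately have "card S' = card S" by (metis card_image)
  moreover have "{\<omega>. ?f (residue k \<omega>) \<in> S} = {\<omega>. residue k \<omega> \<in> S'}"
    using residue_less by (auto simp: S'_def)
  moreover have "S' \<subseteq> {..<L ^ k}" by (auto simp: S'_def)
  ultimately show ?thesis using prob_residue by metis
qed

text \<open>Level \<open>k\<close> determines the coordinates up to distance \<open>m\<close>: they
  lie inside the block containing the origin, without the wrap-around allowed in
  \<open>unresolved\<close>, and on constant columns.\<close>

definition visible :: "nat \<Rightarrow> nat \<Rightarrow> (nat \<Rightarrow> nat discrete) \<Rightarrow> bool" where
  "visible k m \<omega> \<longleftrightarrow> (\<forall>n. \<bar>n\<bar> \<le> int m \<longrightarrow>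
     0 \<le> n + int (residue k \<omega>) \<and> n + int (residue k \<omega>) < int (L ^ k) \<and>
     nat (n + int (residue k \<omega>)) \<notin> NC k)"

definition generic :: "(nat \<Rightarrow> nat discrete) set" where
  "generic = {\<omega>. \<forall>m. \<exists>k. visible k m \<omega>}"

text \<open>The least level is a convenient choice: by \<open>toeplitz_point_eq\<close> any level at
  which the coordinate is visible gives the same letter.\<close>

definition toeplitz_point :: "(nat \<Rightarrow> nat discrete) \<Rightarrow> int \<Rightarrow> 'a" where
  "toeplitz_point \<omega> n =
     (let k = LEAST k. visible k (nat \<bar>n\<bar>) \<omega> in it k 0 ! nat (n + int (residue k \<omega>)))"

text \<open>The block of level \<open>K\<close> is a concatenation of blocks of level
  \<open>k\<close>; the higher digits only say in which of these, the \<open>q\<close>-th, the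
  window lies.\<close>

lemma visible_step:
  assumes "visible k m \<omega>" "k \<le> K" "\<bar>n\<bar> \<le> int m"
  shows "0 \<le> n + int (residue K \<omega>)" "n + int (residue K \<omega>) < int (L ^ K)"
    "nat (n + int (residue K \<omega>)) mod L ^ k = nat (n + int (residue k \<omega>))"
proof -
  define q where "q = residue K \<omega> div L ^ k"
  have R: "residue K \<omega> = q * L ^ k + residue k \<omega>"
    using residue_mod[OF assms(2), of \<omega>] div_mult_mod_eq[of "residue K \<omega>" "L ^ k"] by (simp add: q_def)
  have n: "0 \<le> n + int (residue k \<omega>)" "n + int (residue k \<omega>) < int (L ^ k)"
    using assms unfolding visible_def by blast+
  have R': "n + int (residue K \<omega>) = int (q * L ^ k) + (n + int (residue k \<omega>))"
    unfolding R by simp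
  show "0 \<le> n + int (residue K \<omega>)"
    unfolding R' by (intro add_nonneg_nonneg of_nat_0_le_iff n(1))
  have "q < L ^ (K - k)"
    unfolding q_def using residue_less[of K \<omega>] assms(2)
    by (intro less_mult_imp_div_less) (simp flip: power_add)
  then have "(q + 1) * L ^ k \<le> L ^ (K - k) * L ^ k" by (intro mult_right_mono) auto
  also have "\<dots> = L ^ K" using assms(2) by (simp flip: power_add)
  finally have "int ((q + 1) * L ^ k) \<le> int (L ^ K)" by (simp only: of_nat_le_iff)
  with n(2) show "n + int (residue K \<omega>) < int (L ^ K)"
    unfolding R' by (simp add: distrib_right)
  have "nat (n + int (residue K \<omega>)) = nat (n + int (residue k \<omega>)) + q * L ^ k"
    using n(1) unfolding R' by (subst nat_add_distrib) (simp_all only: of_nat_0_le_iff nat_int add.commute)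
  moreover have "nat (n + int (residue k \<omega>)) < L ^ k" using n by (simp add: nat_less_iff)
  ultimately show "nat (n + int (residue K \<omega>)) mod L ^ k = nat (n + int (residue k \<omega>))" by simp
qed

lemma visible_mono:
  assumes "visible k m \<omega>" "k \<le> K"
  shows "visible K m \<omega>"
  unfolding visible_def
proof (intro allI impI conjI)
  fix n assume n: "\<bar>n\<bar> \<le> int m"
  note step = visible_step[OF assms n]
  show "0 \<le> n + int (residue K \<omega>)" "n + int (residue K \<omega>) < int (L ^ K)" by (fact step)+
  have "nat (n + int (residue k \<omega>)) \<notin> NC k" using assms(1) n unfolding visible_def by blast
  then show "nat (n + int (residue K \<omega>)) \<notin> NC K" using NC_mod[OF _ assms(2)] step(3) by metis
qed

lemma visible_anti: "visible k m \<omega> \<Longrightarrow> m' \<le> m \<Longrightarrow> visible k m' \<omega>"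
  unfolding visible_def by auto

lemma toeplitz_point_eq:
  assumes k: "visible k m \<omega>" and n: "\<bar>n\<bar> \<le> int m"
  shows "toeplitz_point \<omega> n = it k 0 ! nat (n + int (residue k \<omega>))"
proof -
  define k0 where "k0 = (LEAST k. visible k (nat \<bar>n\<bar>) \<omega>)"
  have *: "visible k (nat \<bar>n\<bar>) \<omega>" by (rule visible_anti[OF k]) (use n in simp)
  have k0: "visible k0 (nat \<bar>n\<bar>) \<omega>" "k0 \<le> k"
    using LeastI[of "\<lambda>k. visible k (nat \<bar>n\<bar>) \<omega>", OF *]
      Least_le[of "\<lambda>k. visible k (nat \<bar>n\<bar>) \<omega>", OF *] by (simp_all only: k0_def)
  have "nat (n + int (residue k0 \<omega>)) \<notin> NC k0" using k0(1) unfolding visible_def by simp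
  moreover note step = visible_step[OF k0, of n]
  ultimately have "it k 0 ! nat (n + int (residue k \<omega>)) = it k0 0 ! nat (n + int (residue k0 \<omega>))"
    using it_nth_const[of "nat (n + int (residue k \<omega>))" k k0 0] k0(2) by (simp add: nat_less_iff)
  then show ?thesis by (simp add: toeplitz_point_def k0_def Let_def)
qed

lemma toeplitz_point_resolves:
  assumes "\<omega> \<in> generic"
  shows "resolves k (residue k \<omega>) (toeplitz_point \<omega>)"
  unfolding resolves_def
proof (intro allI impI)
  fix n assume nc: "nat ((n + int (residue k \<omega>)) mod int (L ^ k)) \<notin> NC k"
  obtain K0 where "visible K0 (nat \<bar>n\<bar>) \<omega>" using assms by (auto simp: generic_def)
  \<comment> \<open>The level is raised to at least \<open>k\<close> so that the residue modulo
    \<open>L ^ k\<close> can be recovered from it.\<close>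
  then have K: "visible (max K0 k) (nat \<bar>n\<bar>) \<omega>" (is "visible ?K _ _") by (rule visible_mono) simp
  let ?l = "nat (n + int (residue ?K \<omega>))"
  have l: "0 \<le> n + int (residue ?K \<omega>)" "n + int (residue ?K \<omega>) < int (L ^ ?K)"
    using visible_step[OF K order.refl, of n] by auto
  have "int (?l mod L ^ k) = (n + int (residue ?K \<omega> mod L ^ k)) mod int (L ^ k)"
    using l(1) by (simp add: zmod_int mod_simps)
  also have "residue ?K \<omega> mod L ^ k = residue k \<omega>" by (rule residue_mod) simp
  finally have eq: "?l mod L ^ k = nat ((n + int (residue k \<omega>)) mod int (L ^ k))" by linarith
  have "toeplitz_point \<omega> n = it ?K 0 ! ?l" by (rule toeplitz_point_eq[OF K]) simp
  also have "\<dots> = it k 0 ! (?l mod L ^ k)"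
    by (rule it_nth_const) (use l nc in \<open>auto simp only: eq nat_less_iff max.cobounded2\<close>)
  finally show "toeplitz_point \<omega> n = it k 0 ! nat ((n + int (residue k \<omega>)) mod int (L ^ k))"
    by (simp only: eq)
qed

lemma toeplitz_point_subshift:
  assumes "\<omega> \<in> generic"
  shows "toeplitz_point \<omega> \<in> X"
proof (rule subshiftI)
  fix i :: int and n :: nat assume "1 \<le> n"
  define m where "m = nat (\<bar>i\<bar> + int n)"
  obtain k where "visible k m \<omega>" using assms by (auto simp: generic_def)
  \<comment> \<open>A successor level meets the condition \<open>k \<ge> 1\<close> of
    \<open>subshiftI\<close>.\<close>
  then have k: "visible (Suc k) m \<omega>" by (rule visible_mono) simp
  let ?s = "nat (i + int (residue (Suc k) \<omega>))"
  have pos: "0 \<le> i + int (residue (Suc k) \<omega>)"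
    by (rule visible_step(1)[OF k]) (auto simp: m_def)
  have "i + int n - 1 + int (residue (Suc k) \<omega>) < int (L ^ Suc k)"
    by (rule visible_step(2)[OF k]) (use \<open>1 \<le> n\<close> in \<open>auto simp: m_def\<close>)
  then have "int (?s + n) \<le> int (L ^ Suc k)" using pos by simp
  then have "?s + n \<le> L ^ Suc k" by (simp only: of_nat_le_iff)
  moreover have "toeplitz_point \<omega> (i + int u) = it (Suc k) 0 ! (?s + u)" if "u < n" for u
  proof -
    have "nat (i + int u + int (residue (Suc k) \<omega>)) = ?s + u" using pos by simp
    moreover have "\<bar>i + int u\<bar> \<le> int m" using that by (auto simp: m_def)
    ultimately show ?thesis using toeplitz_point_eq[OF k] by metis
  qed
  ultimately show "\<exists>a k s. 1 \<le> k \<and> s + n \<le> L ^ k \<and> (\<forall>u<n. toeplitz_point \<omega> (i + int u) = it k a ! (s + u))"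
    by (intro exI[of _ 0] exI[of _ "Suc k"] exI[of _ ?s]) auto
qed

text \<open>Each coordinate is locally constant: once visible, it depends on finitely many
  digits.\<close>

lemma continuous_toeplitz_point: "continuous_on generic toeplitz_point"
proof (rule continuous_on_coordinatewise_then_product)
  fix n
  show "continuous_on generic (\<lambda>\<omega>. toeplitz_point \<omega> n)"
    unfolding continuous_on_topological
  proof (intro ballI allI impI)
    fix \<omega> B assume \<omega>: "\<omega> \<in> generic" and B: "toeplitz_point \<omega> n \<in> B"
    obtain k where k: "visible k (nat \<bar>n\<bar>) \<omega>" using \<omega> by (auto simp: generic_def)
    have "toeplitz_point \<omega>' n = toeplitz_point \<omega> n" if eq: "residue k \<omega>' = residue k \<omega>" for \<omega>'
    proof -
      have "visible k (nat \<bar>n\<bar>) \<omega>'" using k by (simp add: visible_def eq)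
      from toeplitz_point_eq[OF this, of n] toeplitz_point_eq[OF k, of n] show ?thesis by (simp add: eq)
    qed
    then have "\<forall>\<omega>'\<in>generic. \<omega>' \<in> {\<omega>'. residue k \<omega>' = residue k \<omega>} \<longrightarrow> toeplitz_point \<omega>' n \<in> B"
      using B by (metis mem_Collect_eq)
    moreover have "open {\<omega>'. residue k \<omega>' = residue k \<omega>}"
      by (rule open_residue[of "\<lambda>t. t = residue k \<omega>"])
    ultimately show "\<exists>A. open A \<and> \<omega> \<in> A \<and> (\<forall>\<omega>'\<in>generic. \<omega>' \<in> A \<longrightarrow> toeplitz_point \<omega>' n \<in> B)"
      by (intro exI[of _ "{\<omega>'. residue k \<omega>' = residue k \<omega>}"] conjI) simp_all
  qed
qed

section \<open>Full measure of the generic digit sequences\<close>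

lemma visible_sets [measurable]: "{\<omega>. visible k m \<omega>} \<in> sets digit_measure"
  using residue_sets[of "\<lambda>t. \<forall>n. \<bar>n\<bar> \<le> int m \<longrightarrow>
    0 \<le> n + int t \<and> n + int t < int (L ^ k) \<and> nat (n + int t) \<notin> NC k" k]
  by (simp only: visible_def)

lemma generic_sets: "generic \<in> sets digit_measure"
proof -
  have "generic = (\<Inter>m. \<Union>k. {\<omega>. visible k m \<omega>})" by (auto simp: generic_def)
  then show ?thesis by simp
qed

text \<open>The window leaves the block for at most \<open>m\<close> residues at either end; apart
  from these, visibility fails only at unresolved residues.\<close>

lemma prob_not_visible:
  "measure digit_measure {\<omega>. \<not> visible k m \<omega>} \<le> real (2 * m) / real (L ^ k) + defect k {- int m..int m}"
proof -
  let ?N = "L ^ k"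
  let ?W = "{- int m..int m}"
  define S where "S = {t. t < ?N \<and> (\<exists>n. \<bar>n\<bar> \<le> int m \<and>
    \<not> (0 \<le> n + int t \<and> n + int t < int ?N \<and> nat (n + int t) \<notin> NC k))}"
  have "S \<subseteq> ({..<m} \<union> {?N - m..<?N}) \<union> unresolved k ?W"
  proof
    fix t assume "t \<in> S"
    then obtain n where t: "t < ?N" "\<bar>n\<bar> \<le> int m"
      "\<not> (0 \<le> n + int t \<and> n + int t < int ?N \<and> nat (n + int t) \<notin> NC k)" by (auto simp: S_def)
    consider "n + int t < 0" | "n + int t \<ge> int ?N"
      | "0 \<le> n + int t" "n + int t < int ?N" "nat (n + int t) \<in> NC k" using t(3) by linarith
    then show "t \<in> ({..<m} \<union> {?N - m..<?N}) \<union> unresolved k ?W"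
    proof cases
      case 3
      then have "nat ((n + int t) mod int ?N) \<in> NC k" by (simp only: mod_pos_pos_trivial)
      moreover have "n \<in> ?W" using t(2) by auto
      ultimately show ?thesis using t(1) unfolding unresolved_def by blast
    next
      case 2
      then have "int ?N \<le> int (m + t)" using t(2) by linarith
      then have "?N \<le> m + t" by (simp only: of_nat_le_iff)
      then show ?thesis using t(1) by auto
    qed (use t in auto)
  qed
  then have "card S \<le> card (({..<m} \<union> {?N - m..<?N}) \<union> unresolved k ?W)"
    by (intro card_mono) auto
  also have "\<dots> \<le> card ({..<m} \<union> {?N - m..<?N}) + card (unresolved k ?W)" by (rule card_Un_le)
  also have "\<dots> \<le> (card {..<m} + card {?N - m..<?N}) + card (unresolved k ?W)"
    by (intro add_right_mono card_Un_le)
  finally have "card S \<le> 2 * m + card (unresolved k ?W)" by simp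
  then have "real (card S) \<le> real (2 * m) + real (card (unresolved k ?W))" by linarith
  then have "card S / real ?N \<le> (real (2 * m) + real (card (unresolved k ?W))) / real ?N"
    by (rule divide_right_mono) simp
  also have "\<dots> \<le> real (2 * m) / real ?N + defect k ?W"
    using card_unresolved[of ?W k] by (simp only: add_divide_distrib) simp
  finally have "card S / real ?N \<le> real (2 * m) / real ?N + defect k ?W" .
  moreover have "{\<omega>. \<not> visible k m \<omega>} = {\<omega>. residue k \<omega> \<in> S}"
    unfolding visible_def S_def using residue_less[of k] by blast
  moreover have "S \<subseteq> {..<?N}" by (auto simp: S_def)
  ultimately show ?thesis using prob_residue[of S k] by simp
qed

lemma AE_generic: "AE \<omega> in digit_measure. \<omega> \<in> generic"
proof -
  have "AE \<omega> in digit_measure. \<exists>k. visible k m \<omega>" for m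
  proof -
    let ?A = "{\<omega>. \<forall>k. \<not> visible k m \<omega>}"
    have A: "?A \<in> sets digit_measure"
    proof -
      have "?A = UNIV - (\<Union>k. {\<omega>. visible k m \<omega>})" by auto
      moreover have "UNIV \<in> sets digit_measure" using sets.top[of digit_measure] by simp
      ultimately show ?thesis by auto
    qed
    have not_visible: "{\<omega>. \<not> visible k m \<omega>} \<in> sets digit_measure" for k
      using sets.compl_sets[OF visible_sets[of k m]] by (simp add: Compl_eq_Diff_UNIV[symmetric] Collect_neg_eq)
    have "measure digit_measure ?A \<le> real (2 * m) / real (L ^ k) + defect k {- int m..int m}" for k
      by (rule order.trans[OF D.finite_measure_mono[OF _ not_visible] prob_not_visible]) auto
    moreover have "(\<lambda>k. real (2 * m) / real (L ^ k) + defect k {- int m..int m}) \<longlonglongrightarrow> 0"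
    proof -
      have "(\<lambda>k. (1 / real L) ^ k) \<longlonglongrightarrow> 0" using L_ge_2 by (intro LIMSEQ_power_zero) simp
      from tendsto_add[OF tendsto_mult_left[OF this, of "real (2 * m)"] defect_tendsto]
      show ?thesis by (simp add: power_divide)
    qed
    ultimately have "measure digit_measure ?A \<le> 0" by (intro LIMSEQ_le_const) auto
    then have "measure digit_measure ?A = 0" using measure_nonneg[of digit_measure ?A] by linarith
    then have "emeasure digit_measure ?A = 0" by (simp add: D.emeasure_eq_measure)
    with A have "?A \<in> null_sets digit_measure" by blast
    from AE_not_in[OF this] show ?thesis by simp
  qed
  then show ?thesis by (simp add: generic_def AE_all_countable)
qed

lemma ex_generic: "\<exists>\<omega>. \<omega> \<in> generic"
proof (rule ccontr)
  assume "\<not> ?thesis"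
  with AE_generic have "AE \<omega> in digit_measure. False" by simp
  then show False by (simp add: D.AE_False)
qed

text \<open>Sequences outside \<open>generic\<close> are sent to one fixed Toeplitz point, which
  keeps all values in the subshift and provides the constancy asked for in
  \<open>regular_distr\<close>.\<close>

definition coding :: "(nat \<Rightarrow> nat discrete) \<Rightarrow> int \<Rightarrow> 'a" where
  "coding \<omega> = toeplitz_point (if \<omega> \<in> generic then \<omega> else SOME \<omega>. \<omega> \<in> generic)"

lemma coding_subshift: "coding \<omega> \<in> X"
  unfolding coding_def using someI_ex[OF ex_generic] by (intro toeplitz_point_subshift) simp

lemma subshift_nonempty: "X \<noteq> {}"
  using coding_subshift by blast

lemma coding_resolves: "\<omega> \<in> generic \<Longrightarrow> resolves k (residue k \<omega>) (coding \<omega>)"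
  by (simp add: coding_def toeplitz_point_resolves)

lemma continuous_coding: "continuous_on generic coding"
  using continuous_toeplitz_point by (rule continuous_on_eq) (simp add: coding_def)

lemma coding_not_generic: "\<omega> \<notin> generic \<Longrightarrow> coding \<omega> = toeplitz_point (SOME \<omega>. \<omega> \<in> generic)"
  by (simp add: coding_def)

section \<open>The invariant measure as an image measure\<close>

definition subshift_measure :: "(int \<Rightarrow> 'a) measure" where
  "subshift_measure = distr digit_measure (restrict_space borel X) coding"

lemmas regular_distr_digits = regular_distr[OF D.prob_space_axioms sets_digit_measure
    generic_sets[unfolded sets_digit_measure] AE_generic]

lemma measurable_coding: "coding \<in> measurable digit_measure (restrict_space borel X)"
  using continuous_coding coding_not_generic coding_subshift by (rule regular_distr_digits(1))

lemma regular_subshift_measure: "regular_borel_prob X subshift_measure"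
  unfolding subshift_measure_def
  using continuous_coding coding_not_generic coding_subshift by (rule regular_distr_digits(2))

text \<open>Outside the unresolved residues, belonging to the cylinder is decided by the rotated
  residue, which is uniformly distributed. The offset \<open>i\<close> is 0 for the coding map and 1
  for its shift.\<close>

lemma prob_cylinder_approx:
  assumes \<Psi>: "\<Psi> \<in> measurable digit_measure (restrict_space borel X)"
    and res: "\<And>\<omega>. \<omega> \<in> generic \<Longrightarrow> resolves k (i + residue k \<omega>) (\<Psi> \<omega>)"
    and V: "cylinder W V"
  shows "norm (complex_of_real (measure (distr digit_measure (restrict_space borel X) \<Psi>) (V \<inter> X))
    - periodic_average 1 k V) \<le> defect k W"
proof -
  let ?N = "L ^ k" and ?D = "digit_measure"
  let ?f = "\<lambda>\<omega>. (i + residue k \<omega>) mod ?N"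
  define S where "S = {t. t < ?N \<and> periodic_point k t \<in> V}"
  let ?A = "\<Psi> -` (V \<inter> X)"
  have VX: "V \<inter> X \<in> sets (restrict_space borel X)"
    by (rule open_Int_in_sets[OF refl]) (use V in \<open>simp add: cylinder_def\<close>)
  have A: "?A \<in> sets ?D" using measurable_sets[OF \<Psi> VX] by simp
  have range: "\<Psi> \<omega> \<in> X" for \<omega>
    using measurable_space[OF \<Psi>, of \<omega>] by (simp add: space_restrict_space)
  have eq: "\<omega> \<in> ?A \<longleftrightarrow> ?f \<omega> \<in> S" if "\<omega> \<in> generic" "?f \<omega> \<notin> unresolved k W" for \<omega>
    using resolves_cylinder[OF res[OF that(1)] V that(2)] range by (simp add: S_def)
  have meas: "{\<omega>. ?f \<omega> \<in> T} \<in> sets ?D" for T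
    using residue_sets[of "\<lambda>t. (i + t) mod ?N \<in> T" k] .
  have sub: "S \<subseteq> {..<?N}" "unresolved k W \<subseteq> {..<?N}" by (auto simp: S_def unresolved_def)
  have "measure ?D ?A \<le> measure ?D ({\<omega>. ?f \<omega> \<in> S} \<union> {\<omega>. ?f \<omega> \<in> unresolved k W})"
    by (rule D.finite_measure_mono_AE[OF eventually_mono[OF AE_generic]]) (use eq meas in auto)
  also have "\<dots> \<le> measure ?D {\<omega>. ?f \<omega> \<in> S} + measure ?D {\<omega>. ?f \<omega> \<in> unresolved k W}"
    by (rule measure_Un_le[OF meas meas])
  finally have 1: "measure ?D ?A \<le> measure ?D {\<omega>. ?f \<omega> \<in> S} + measure ?D {\<omega>. ?f \<omega> \<in> unresolved k W}" .
  have "measure ?D {\<omega>. ?f \<omega> \<in> S} \<le> measure ?D (?A \<union> {\<omega>. ?f \<omega> \<in> unresolved k W})"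
    by (rule D.finite_measure_mono_AE[OF eventually_mono[OF AE_generic]]) (use eq meas A in auto)
  also have "\<dots> \<le> measure ?D ?A + measure ?D {\<omega>. ?f \<omega> \<in> unresolved k W}"
    by (rule measure_Un_le[OF A meas])
  finally have "\<bar>measure ?D ?A - measure ?D {\<omega>. ?f \<omega> \<in> S}\<bar> \<le> measure ?D {\<omega>. ?f \<omega> \<in> unresolved k W}"
    using 1 by linarith
  also have "\<dots> \<le> defect k W"
    unfolding prob_residue_rotate[OF sub(2)] using V by (intro card_unresolved) (simp add: cylinder_def)
  finally have "\<bar>measure ?D ?A - card S / real ?N\<bar> \<le> defect k W"
    by (simp only: prob_residue_rotate[OF sub(1)])
  moreover have "periodic_average 1 k V = complex_of_real (card S / real ?N)"
  proof -
    have "{..<?N} \<inter> {t. periodic_point k t \<in> V} = S" by (auto simp: S_def)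
    then show ?thesis by (simp add: periodic_average_def indicator_def sum.If_cases)
  qed
  moreover have "measure (distr ?D (restrict_space borel X) \<Psi>) (V \<inter> X) = measure ?D ?A"
    by (simp add: measure_distr[OF \<Psi> VX])
  ultimately show ?thesis by (simp only: of_real_diff[symmetric] norm_of_real)
qed

text \<open>Shifting the coding map rotates residues by one, which leaves their distribution
  unchanged; hence both image measures have the same periodic averages as limits on
  cylinders.\<close>

lemma invariant_subshift_measure: "invariant_prob X left_shift subshift_measure"
  unfolding invariant_prob_def
proof (intro conjI regular_subshift_measure)
  let ?R = "restrict_space borel X"
  have sets: "sets subshift_measure = sets ?R" by (simp add: subshift_measure_def)
  show "left_shift \<in> measurable subshift_measure subshift_measure"
    using measurable_left_shift by (simp add: measurable_cong_sets[OF sets sets])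
  have shifted: "regular_borel_prob X (distr digit_measure ?R (left_shift \<circ> coding))"
  proof (rule regular_distr_digits(2))
    show "continuous_on generic (left_shift \<circ> coding)"
      by (rule continuous_on_compose[OF continuous_coding continuous_left_shift])
    show "(left_shift \<circ> coding) \<omega> \<in> X" for \<omega>
      by (simp add: left_shift_subshift coding_subshift)
    show "(left_shift \<circ> coding) \<omega> = left_shift (toeplitz_point (SOME \<omega>. \<omega> \<in> generic))"
      if "\<omega> \<notin> generic" for \<omega>
      using that by (simp add: coding_not_generic)
  qed
  have "distr subshift_measure subshift_measure left_shift = distr subshift_measure ?R left_shift"
    by (rule distr_cong) (simp_all add: sets)
  also have "\<dots> = distr digit_measure ?R (left_shift \<circ> coding)"
    unfolding subshift_measure_def by (rule distr_distr[OF measurable_left_shift measurable_coding])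
  also have "\<dots> = subshift_measure"
  proof (rule regular_measures_eq[OF shifted regular_subshift_measure])
    fix W k and V :: "(int \<Rightarrow> 'a) set" assume V: "cylinder W V"
    have "resolves k (1 + residue k \<omega>) ((left_shift \<circ> coding) \<omega>)" if "\<omega> \<in> generic" for \<omega>
      using resolves_shift[OF coding_resolves[OF that], of k 1] by simp
    from prob_cylinder_approx[OF measurable_comp[OF measurable_coding measurable_left_shift] this V]
    show "norm (complex_of_real (measure (distr digit_measure ?R (left_shift \<circ> coding)) (V \<inter> X))
        - periodic_average 1 k V) \<le> defect k W" by (simp only: comp_def)
    show "norm (complex_of_real (measure subshift_measure (V \<inter> X)) - periodic_average 1 k V) \<le> defect k W"
      unfolding subshift_measure_def
      by (rule prob_cylinder_approx[OF measurable_coding _ V, of k 0]) (simp add: coding_resolves)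
  qed (rule defect_tendsto)+
  finally show "distr subshift_measure subshift_measure left_shift = subshift_measure" .
qed

lemma uniquely_ergodic_subshift: "uniquely_ergodic X left_shift"
  unfolding uniquely_ergodic_def
  using invariant_subshift_measure invariant_measure_unique by blast

lemma the_invariant_measure: "(THE \<mu>. invariant_prob X left_shift \<mu>) = subshift_measure"
  using invariant_subshift_measure invariant_measure_unique by blast

end

section \<open>Approximation in mean square\<close>

text \<open>Membership in the closed linear span of \<open>B\<close>, that is the completeness
  clause of \<open>orthonormal_basis\<close> for a single function.\<close>

definition mean_square_span :: "'x measure \<Rightarrow> ('x \<Rightarrow> complex) set \<Rightarrow> ('x \<Rightarrow> complex) \<Rightarrow> bool" where
  "mean_square_span M B h \<longleftrightarrow> (\<forall>\<epsilon>>0. \<exists>F c. finite F \<and> F \<subseteq> B \<and>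
     (LINT x|M. (cmod (h x - (\<Sum>f\<in>F. c f * f x)))\<^sup>2) < \<epsilon>)"

lemma norm_add_squared_le: "(cmod (a + b))\<^sup>2 \<le> 2 * (cmod a)\<^sup>2 + 2 * (cmod b)\<^sup>2"
proof -
  have "(cmod (a + b))\<^sup>2 \<le> (cmod a + cmod b)\<^sup>2" by (intro power_mono norm_triangle_ineq) simp
  also have "\<dots> \<le> 2 * (cmod a)\<^sup>2 + 2 * (cmod b)\<^sup>2"
    using sum_squares_bound[of "cmod a" "cmod b"] by (simp add: power2_sum)
  finally show ?thesis .
qed

lemma square_integrable_cong:
  assumes "\<And>x. x \<in> space M \<Longrightarrow> f x = g x" "square_integrable M f"
  shows "square_integrable M g"
proof -
  have "f \<in> borel_measurable M \<longleftrightarrow> g \<in> borel_measurable M"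
    using assms(1) by (rule measurable_cong)
  moreover have "integrable M (\<lambda>x. (cmod (f x))\<^sup>2) \<longleftrightarrow> integrable M (\<lambda>x. (cmod (g x))\<^sup>2)"
    using assms(1) by (intro Bochner_Integration.integrable_cong) auto
  ultimately show ?thesis using assms(2) by (simp add: square_integrable_def)
qed

lemma square_integrable_add:
  assumes "square_integrable M f" "square_integrable M g"
  shows "square_integrable M (\<lambda>x. f x + g x)"
proof -
  have [measurable]: "f \<in> borel_measurable M" "g \<in> borel_measurable M"
    using assms by (auto simp: square_integrable_def)
  have "integrable M (\<lambda>x. 2 * (cmod (f x))\<^sup>2 + 2 * (cmod (g x))\<^sup>2)"
    using assms by (auto simp: square_integrable_def)
  then have "integrable M (\<lambda>x. (cmod (f x + g x))\<^sup>2)"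
    by (rule Bochner_Integration.integrable_bound) (auto intro!: AE_I2 norm_add_squared_le)
  then show ?thesis by (simp add: square_integrable_def)
qed

lemma square_integrable_scale:
  assumes "square_integrable M f"
  shows "square_integrable M (\<lambda>x. c * f x)"
  using assms by (auto simp: square_integrable_def norm_mult power_mult_distrib)

lemma square_integrable_diff:
  assumes "square_integrable M f" "square_integrable M g"
  shows "square_integrable M (\<lambda>x. f x - g x)"
  using square_integrable_add[OF assms(1) square_integrable_scale[OF assms(2), of "- 1"]] by simp

lemma square_integrable_sum:
  assumes "\<And>i. i \<in> I \<Longrightarrow> square_integrable M (f i)"
  shows "square_integrable M (\<lambda>x. \<Sum>i\<in>I. f i x)"
  using assms
proof (induction I rule: infinite_finite_induct)
  case (insert i I)
  then show ?case by (simp add: square_integrable_add)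
qed (auto simp: square_integrable_def)

lemma square_integrable_combination:
  assumes "\<And>f. f \<in> F \<Longrightarrow> square_integrable M f"
  shows "square_integrable M (\<lambda>x. \<Sum>f\<in>F. c f * f x)"
  by (intro square_integrable_sum square_integrable_scale assms)

lemma integral_add_squared_le:
  assumes "square_integrable M f" "square_integrable M g"
  shows "(LINT x|M. (cmod (f x + g x))\<^sup>2)
    \<le> 2 * (LINT x|M. (cmod (f x))\<^sup>2) + 2 * (LINT x|M. (cmod (g x))\<^sup>2)"
proof -
  have int: "integrable M (\<lambda>x. (cmod (f x))\<^sup>2)" "integrable M (\<lambda>x. (cmod (g x))\<^sup>2)"
    "integrable M (\<lambda>x. (cmod (f x + g x))\<^sup>2)"
    using assms square_integrable_add[OF assms] by (auto simp: square_integrable_def)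
  then have "(LINT x|M. (cmod (f x + g x))\<^sup>2) \<le> (LINT x|M. 2 * (cmod (f x))\<^sup>2 + 2 * (cmod (g x))\<^sup>2)"
    by (intro integral_mono norm_add_squared_le) auto
  also have "\<dots> = 2 * (LINT x|M. (cmod (f x))\<^sup>2) + 2 * (LINT x|M. (cmod (g x))\<^sup>2)"
    using int by simp
  finally show ?thesis .
qed

section \<open>Closure properties of the mean-square span\<close>

context
  fixes M :: "'x measure" and B :: "('x \<Rightarrow> complex) set"
  assumes B: "\<And>f. f \<in> B \<Longrightarrow> square_integrable M f"
begin

lemma mean_square_span_limit:
  assumes h: "square_integrable M h"
    and approx: "\<And>\<epsilon>. \<epsilon> > 0 \<Longrightarrow> \<exists>g. square_integrable M g \<and> mean_square_span M B g \<and>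
      (LINT x|M. (cmod (h x - g x))\<^sup>2) < \<epsilon>"
  shows "mean_square_span M B h"
  unfolding mean_square_span_def
proof (intro allI impI)
  fix \<epsilon> :: real assume "\<epsilon> > 0"
  \<comment> \<open>\<open>integral_add_squared_le\<close> doubles each of the two errors, and twice
    two quarters make \<epsilon>.\<close>
  then have \<epsilon>: "\<epsilon> / 4 > 0" by simp
  obtain g where g: "square_integrable M g" "mean_square_span M B g"
    "(LINT x|M. (cmod (h x - g x))\<^sup>2) < \<epsilon> / 4" using approx[OF \<epsilon>] by blast
  obtain F c where F: "finite F" "F \<subseteq> B" "(LINT x|M. (cmod (g x - (\<Sum>f\<in>F. c f * f x)))\<^sup>2) < \<epsilon> / 4"
    using g(2) \<epsilon> unfolding mean_square_span_def by blast
  have "square_integrable M (\<lambda>x. \<Sum>f\<in>F. c f * f x)"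
    using F(2) B by (intro square_integrable_combination) auto
  from integral_add_squared_le[OF square_integrable_diff[OF h g(1)] square_integrable_diff[OF g(1) this]]
  have "(LINT x|M. (cmod (h x - (\<Sum>f\<in>F. c f * f x)))\<^sup>2) < \<epsilon>"
    using g(3) F(3) by simp
  with F show "\<exists>F c. finite F \<and> F \<subseteq> B \<and> (LINT x|M. (cmod (h x - (\<Sum>f\<in>F. c f * f x)))\<^sup>2) < \<epsilon>"
    by blast
qed

lemma mean_square_span_add:
  assumes sq: "square_integrable M g" "square_integrable M h"
    and "mean_square_span M B g" "mean_square_span M B h"
  shows "mean_square_span M B (\<lambda>x. g x + h x)"
  unfolding mean_square_span_def
proof (intro allI impI)
  fix \<epsilon> :: real assume "\<epsilon> > 0"
  then have \<epsilon>: "\<epsilon> / 4 > 0" by simp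
  obtain F c where F: "finite F" "F \<subseteq> B" "(LINT x|M. (cmod (g x - (\<Sum>f\<in>F. c f * f x)))\<^sup>2) < \<epsilon> / 4"
    using assms(3) \<epsilon> unfolding mean_square_span_def by blast
  obtain F' c' where F': "finite F'" "F' \<subseteq> B"
    "(LINT x|M. (cmod (h x - (\<Sum>f\<in>F'. c' f * f x)))\<^sup>2) < \<epsilon> / 4"
    using assms(4) \<epsilon> unfolding mean_square_span_def by blast
  \<comment> \<open>The two families may overlap, so both coefficient functions are extended by zero
    and added.\<close>
  define d where "d f = (if f \<in> F then c f else 0) + (if f \<in> F' then c' f else 0)" for f
  have "(\<Sum>f\<in>F \<union> F'. d f * f x) = (\<Sum>f\<in>F. c f * f x) + (\<Sum>f\<in>F'. c' f * f x)" for x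
  proof -
    have "(\<Sum>f\<in>F \<union> F'. d f * f x)
        = (\<Sum>f\<in>F \<union> F'. if f \<in> F then c f * f x else 0) + (\<Sum>f\<in>F \<union> F'. if f \<in> F' then c' f * f x else 0)"
      unfolding sum.distrib[symmetric] by (rule sum.cong) (auto simp: d_def distrib_right)
    also have "(\<Sum>f\<in>F \<union> F'. if f \<in> F then c f * f x else 0) = (\<Sum>f\<in>F. c f * f x)"
      using F(1) F'(1) by (simp add: sum.inter_restrict[symmetric] Int_absorb1)
    also have "(\<Sum>f\<in>F \<union> F'. if f \<in> F' then c' f * f x else 0) = (\<Sum>f\<in>F'. c' f * f x)"
      using F(1) F'(1) by (simp add: sum.inter_restrict[symmetric] Int_absorb1)
    finally show ?thesis .
  qed
  then have eq: "g x + h x - (\<Sum>f\<in>F \<union> F'. d f * f x)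
      = (g x - (\<Sum>f\<in>F. c f * f x)) + (h x - (\<Sum>f\<in>F'. c' f * f x))" for x
    by simp
  have "square_integrable M (\<lambda>x. \<Sum>f\<in>F. c f * f x)" "square_integrable M (\<lambda>x. \<Sum>f\<in>F'. c' f * f x)"
    using F(2) F'(2) B by (auto intro!: square_integrable_combination)
  from integral_add_squared_le[OF square_integrable_diff[OF sq(1) this(1)] square_integrable_diff[OF sq(2) this(2)]]
  have "(LINT x|M. (cmod (g x + h x - (\<Sum>f\<in>F \<union> F'. d f * f x)))\<^sup>2) < \<epsilon>"
    unfolding eq using F(3) F'(3) by simp
  then show "\<exists>F c. finite F \<and> F \<subseteq> B \<and> (LINT x|M. (cmod (g x + h x - (\<Sum>f\<in>F. c f * f x)))\<^sup>2) < \<epsilon>"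
    using F F' by (intro exI[of _ "F \<union> F'"] exI[of _ d]) auto
qed

lemma mean_square_span_scale:
  assumes "mean_square_span M B h"
  shows "mean_square_span M B (\<lambda>x. a * h x)"
  unfolding mean_square_span_def
proof (intro allI impI)
  fix \<epsilon> :: real assume \<epsilon>: "\<epsilon> > 0"
  \<comment> \<open>The summand 1 keeps the divisor positive when \<open>a = 0\<close>.\<close>
  have pos: "(cmod a)\<^sup>2 + 1 > 0" by (simp add: add_nonneg_pos)
  then obtain F c where F: "finite F" "F \<subseteq> B"
    "(LINT x|M. (cmod (h x - (\<Sum>f\<in>F. c f * f x)))\<^sup>2) < \<epsilon> / ((cmod a)\<^sup>2 + 1)" (is "?I < _")
    using assms \<epsilon> unfolding mean_square_span_def by (meson divide_pos_pos)
  have "(LINT x|M. (cmod (a * h x - (\<Sum>f\<in>F. (a * c f) * f x)))\<^sup>2) = (cmod a)\<^sup>2 * ?I"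
    by (simp add: mult.assoc norm_mult power_mult_distrib
        flip: sum_distrib_left right_diff_distrib integral_mult_right_zero)
  also have "\<dots> \<le> ((cmod a)\<^sup>2 + 1) * ?I" by (intro mult_right_mono) auto
  also have "\<dots> < \<epsilon>" using F(3) pos by (simp add: pos_less_divide_eq mult.commute)
  finally show "\<exists>F c. finite F \<and> F \<subseteq> B \<and> (LINT x|M. (cmod (a * h x - (\<Sum>f\<in>F. c f * f x)))\<^sup>2) < \<epsilon>"
    using F by (intro exI[of _ F] exI[of _ "\<lambda>f. a * c f"]) auto
qed

lemma mean_square_span_sum:
  assumes "\<And>i. i \<in> I \<Longrightarrow> square_integrable M (h i) \<and> mean_square_span M B (h i)"
  shows "mean_square_span M B (\<lambda>x. \<Sum>i\<in>I. h i x)"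
  using assms
proof (induction I rule: infinite_finite_induct)
  case (insert i I)
  then show ?case by (simp add: mean_square_span_add square_integrable_sum)
qed (auto simp: mean_square_span_def intro!: exI[of _ "{}"])

lemma mean_square_span_cong:
  assumes "\<And>x. x \<in> space M \<Longrightarrow> g x = h x" "mean_square_span M B g"
  shows "mean_square_span M B h"
proof -
  have "(LINT x|M. (cmod (g x - (\<Sum>f\<in>F. c f * f x)))\<^sup>2) = (LINT x|M. (cmod (h x - (\<Sum>f\<in>F. c f * f x)))\<^sup>2)"
    for F c using assms(1) by (intro Bochner_Integration.integral_cong) auto
  with assms(2) show ?thesis by (simp add: mean_square_span_def)
qed

lemma mean_square_span_total:
  assumes M: "finite_measure M"
    and ind: "\<And>E. E \<in> sets M \<Longrightarrow> mean_square_span M B (indicator E)"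
    and h: "square_integrable M h"
  shows "mean_square_span M B h"
proof -
  interpret finite_measure M by fact
  have sq_ind: "square_integrable M (indicator E)" if "E \<in> sets M" for E
    unfolding square_integrable_def
    using that by (auto intro!: integrable_const_bound[of _ 1] simp: indicator_def)
  have simple: "square_integrable M s \<and> mean_square_span M B s" if s: "simple_function M s" for s
  proof -
    have fin: "finite (s ` space M)" and E: "\<And>y. s -` {y} \<inter> space M \<in> sets M"
      using s by (auto simp: simple_function_def intro: simple_functionD)
    have eq: "s x = (\<Sum>y\<in>s ` space M. y * indicator (s -` {y} \<inter> space M) x)" if "x \<in> space M" for x
    proof -
      have "(\<Sum>y\<in>s ` space M. y * indicator (s -` {y} \<inter> space M) x)
          = (\<Sum>y\<in>s ` space M. if y = s x then y else 0)"
        using that by (intro sum.cong) (auto simp: indicator_def)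
      with that fin show ?thesis by simp
    qed
    have "mean_square_span M B s"
      by (rule mean_square_span_cong[OF eq[symmetric]])
        (auto intro!: mean_square_span_sum mean_square_span_scale square_integrable_scale sq_ind ind E)
    moreover have "square_integrable M s"
      by (rule square_integrable_cong[OF eq[symmetric]])
        (auto intro!: square_integrable_sum square_integrable_scale sq_ind E)
    ultimately show ?thesis by blast
  qed
  have [measurable]: "h \<in> borel_measurable M" and int: "integrable M (\<lambda>x. (cmod (h x))\<^sup>2)"
    using h by (auto simp: square_integrable_def)
  obtain s where s: "\<And>i. simple_function M (s i)" "\<And>x. x \<in> space M \<Longrightarrow> (\<lambda>i. s i x) \<longlonglongrightarrow> h x"
    "\<And>i x. x \<in> space M \<Longrightarrow> norm (s i x) \<le> 2 * norm (h x)"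
    using borel_measurable_implies_sequence_metric[OF \<open>h \<in> borel_measurable M\<close>, of 0]
    unfolding norm_conv_dist by metis
  have [measurable]: "s i \<in> borel_measurable M" for i
    using s(1) by (rule borel_measurable_simple_function)
  have "(\<lambda>i. LINT x|M. (cmod (h x - s i x))\<^sup>2) \<longlonglongrightarrow> (LINT x|M. 0)"
  \<comment> \<open>The approximants satisfy \<open>cmod (s i x) \<le> 2 * cmod (h x)\<close>, so
    the difference is at most three times \<open>cmod (h x)\<close>.\<close>
  proof (rule integral_dominated_convergence[where w = "\<lambda>x. 9 * (cmod (h x))\<^sup>2"])
    show "AE x in M. (\<lambda>i. (cmod (h x - s i x))\<^sup>2) \<longlonglongrightarrow> 0"
    proof (rule AE_I2)
      fix x assume "x \<in> space M"
      from tendsto_power[OF tendsto_norm[OF tendsto_diff[OF tendsto_const[of "h x"] s(2)[OF this]]], of 2]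
      show "(\<lambda>i. (cmod (h x - s i x))\<^sup>2) \<longlonglongrightarrow> 0" by simp
    qed
    show "AE x in M. norm ((cmod (h x - s i x))\<^sup>2) \<le> 9 * (cmod (h x))\<^sup>2" for i
    proof (rule AE_I2)
      fix x assume "x \<in> space M"
      then have "cmod (h x - s i x) \<le> 3 * cmod (h x)"
        using s(3)[of x i] norm_triangle_ineq4[of "h x" "s i x"] by simp
      from power_mono[OF this, of 2] show "norm ((cmod (h x - s i x))\<^sup>2) \<le> 9 * (cmod (h x))\<^sup>2"
        by (simp add: power_mult_distrib)
    qed
  qed (use int in auto)
  then have lim: "(\<lambda>i. LINT x|M. (cmod (h x - s i x))\<^sup>2) \<longlonglongrightarrow> 0" by simp
  show ?thesis
  proof (rule mean_square_span_limit[OF h])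
    fix \<epsilon> :: real assume "\<epsilon> > 0"
    from order_tendstoD(2)[OF lim this] obtain i where "(LINT x|M. (cmod (h x - s i x))\<^sup>2) < \<epsilon>"
      unfolding eventually_sequentially by blast
    with simple[OF s(1)[of i]] show "\<exists>g. square_integrable M g \<and> mean_square_span M B g \<and>
        (LINT x|M. (cmod (h x - g x))\<^sup>2) < \<epsilon>" by blast
  qed
qed

end

section \<open>Pure point spectrum\<close>

text \<open>Multiplication by a primitive root \<omega> permutes the roots and multiplies the sum of
  \<open>i\<close>-th powers by \<open>\<omega> ^ i\<close>, which differs from 1 unless
  \<open>N\<close> divides \<open>i\<close>.\<close>

lemma sum_power_roots_of_unity:
  assumes "N > 0"
  shows "(\<Sum>z | z ^ N = 1. cnj z ^ i) = (if N dvd i then of_nat N else (0::complex))"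
proof (cases "N dvd i")
  case True
  then obtain m where m: "i = N * m" by blast
  have "cnj z ^ i = 1" if "z ^ N = 1" for z :: complex
    using that unfolding m power_mult by (metis complex_cnj_one complex_cnj_power power_one)
  then show ?thesis using True assms by (simp add: card_roots_unity_eq)
next
  case False
  define \<omega> where "\<omega> = exp (2 * of_real pi * \<i> * of_nat 1 / of_nat N)"
  have pow: "\<omega> ^ j = exp (2 * of_real pi * \<i> * of_nat j / of_nat N)" for j
    unfolding \<omega>_def exp_of_nat_mult[symmetric] by (simp add: mult_ac)
  have \<omega>: "\<omega> ^ j = 1 \<longleftrightarrow> N dvd j" for j
    using complex_root_unity_eq[of N j 0] assms unfolding pow by (simp add: dvd_eq_mod_eq_0)
  have "\<omega> ^ N = 1" using \<omega> by simp
  then have nz: "\<omega> \<noteq> 0" using assms by (metis power_0_left zero_neq_one neq0_conv)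
  have bij: "bij_betw (\<lambda>z. \<omega> * z) {z. z ^ N = 1} {z. z ^ N = 1}"
    using nz \<open>\<omega> ^ N = 1\<close>
    by (intro bij_betwI[where g = "\<lambda>z. z / \<omega>"]) (auto simp: power_mult_distrib power_divide)
  have "(\<Sum>z | z ^ N = 1. z ^ i :: complex) = (\<Sum>z | z ^ N = 1. (\<omega> * z) ^ i)"
    by (rule sum.reindex_bij_betw[OF bij, symmetric])
  also have "\<dots> = \<omega> ^ i * (\<Sum>z | z ^ N = 1. z ^ i)"
    by (simp add: power_mult_distrib sum_distrib_left)
  finally have "(\<Sum>z | z ^ N = 1. z ^ i :: complex) = 0" using \<omega>[of i] False by simp
  then have "cnj (\<Sum>z | z ^ N = 1. z ^ i) = 0" by simp
  then show ?thesis using False by simp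
qed

context invariant_measure
begin

section \<open>Eigenvalues and normalised eigenfunctions\<close>

definition base_point :: "int \<Rightarrow> 'a" where
  "base_point = (SOME x. x \<in> X)"

lemma base_point: "base_point \<in> X"
  unfolding base_point_def using subshift_nonempty by (simp add: some_in_eq)

text \<open>Testing at one point suffices, since a component vanishes everywhere or nowhere.\<close>

definition eigenvalues :: "complex set" where
  "eigenvalues = {\<zeta>. (\<exists>k. \<zeta> ^ (L ^ k) = 1) \<and>
     (\<exists>W V. cylinder W V \<and> spectral_component \<zeta> V base_point \<noteq> 0)}"

text \<open>Normalised to be 1 at the base point; by \<open>spectral_component_proportional\<close>
  the chosen \<open>V\<close> does not affect the values on the subshift.\<close>

definition eigenfunction :: "complex \<Rightarrow> (int \<Rightarrow> 'a) \<Rightarrow> complex" where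
  "eigenfunction \<zeta> x = (let V = (SOME V. (\<exists>W. cylinder W V) \<and> spectral_component \<zeta> V base_point \<noteq> 0)
     in spectral_component \<zeta> V x / spectral_component \<zeta> V base_point)"

lemma eigenfunctionE:
  assumes "\<zeta> \<in> eigenvalues"
  obtains k W V where "\<zeta> ^ (L ^ k) = 1" "cylinder W V" "spectral_component \<zeta> V base_point \<noteq> 0"
    "eigenfunction \<zeta> = (\<lambda>x. spectral_component \<zeta> V x / spectral_component \<zeta> V base_point)"
proof -
  define V where "V = (SOME V. (\<exists>W. cylinder W V) \<and> spectral_component \<zeta> V base_point \<noteq> 0)"
  have "\<exists>V. (\<exists>W. cylinder W V) \<and> spectral_component \<zeta> V base_point \<noteq> 0"
    using assms unfolding eigenvalues_def by blast
  then have "(\<exists>W. cylinder W V) \<and> spectral_component \<zeta> V base_point \<noteq> 0"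
    unfolding V_def by (rule someI_ex)
  moreover have "eigenfunction \<zeta> = (\<lambda>x. spectral_component \<zeta> V x / spectral_component \<zeta> V base_point)"
    by (rule ext) (simp only: eigenfunction_def V_def Let_def)
  moreover obtain k where "\<zeta> ^ (L ^ k) = 1" using assms unfolding eigenvalues_def by blast
  ultimately show thesis using that by blast
qed

lemma measurable_spectral_component:
  assumes "\<zeta> ^ (L ^ k) = 1" "cylinder W V"
  shows "spectral_component \<zeta> V \<in> borel_measurable M"
  by (rule borel_measurable_LIMSEQ_metric[where f = "\<lambda>k. twisted_average \<zeta> k V"])
    (use assms twisted_average_tendsto in \<open>auto intro: measurable_twisted_average\<close>)

lemma eigenfunction_shift:
  assumes "\<zeta> \<in> eigenvalues" "x \<in> X"
  shows "eigenfunction \<zeta> (left_shift x) = \<zeta> * eigenfunction \<zeta> x"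
  by (rule eigenfunctionE[OF assms(1)]) (simp add: spectral_component_shift assms(2))

lemma eigenfunction_base_point: "\<zeta> \<in> eigenvalues \<Longrightarrow> eigenfunction \<zeta> base_point = 1"
  by (rule eigenfunctionE) auto

lemma norm_eigenfunction:
  assumes "\<zeta> \<in> eigenvalues" "x \<in> X"
  shows "norm (eigenfunction \<zeta> x) = 1"
proof -
  obtain k W V where *: "\<zeta> ^ (L ^ k) = 1" "cylinder W V" "spectral_component \<zeta> V base_point \<noteq> 0"
    "eigenfunction \<zeta> = (\<lambda>x. spectral_component \<zeta> V x / spectral_component \<zeta> V base_point)"
    by (rule eigenfunctionE[OF assms(1)])
  from spectral_component_norm_eq[OF *(1,2) assms(2) base_point] *(3,4)
  show ?thesis by (simp add: norm_divide)
qed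

lemma measurable_eigenfunction:
  assumes "\<zeta> \<in> eigenvalues"
  shows "eigenfunction \<zeta> \<in> borel_measurable M"
proof -
  obtain k W V where *: "\<zeta> ^ (L ^ k) = 1" "cylinder W V" "spectral_component \<zeta> V base_point \<noteq> 0"
    "eigenfunction \<zeta> = (\<lambda>x. spectral_component \<zeta> V x / spectral_component \<zeta> V base_point)"
    by (rule eigenfunctionE[OF assms])
  show ?thesis unfolding *(4) using measurable_spectral_component[OF *(1,2)] by measurable
qed

lemma square_integrable_bounded:
  assumes "f \<in> borel_measurable M" "\<And>x. x \<in> X \<Longrightarrow> norm (f x) \<le> c"
  shows "square_integrable M f"
  unfolding square_integrable_def
proof (intro conjI assms(1) integrable_const_bound[of _ "c\<^sup>2"] AE_I2)
  show "norm ((cmod (f x))\<^sup>2) \<le> c\<^sup>2" if "x \<in> space M" for x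
    using power_mono[OF assms(2)[of x], of 2] that by simp
qed (use assms(1) in measurable)

lemma square_integrable_eigenfunction:
  "\<zeta> \<in> eigenvalues \<Longrightarrow> square_integrable M (eigenfunction \<zeta>)"
  by (rule square_integrable_bounded[of _ 1]) (simp_all add: measurable_eigenfunction norm_eigenfunction)

text \<open>The value at the shifted base point is the eigenvalue itself. This matches the indexing
  by functions in \<open>orthonormal_basis\<close> with the indexing by eigenvalues.\<close>

lemma eigenfunction_inject:
  assumes "\<zeta> \<in> eigenvalues" "\<zeta>' \<in> eigenvalues" "eigenfunction \<zeta> = eigenfunction \<zeta>'"
  shows "\<zeta> = \<zeta>'"
proof -
  have "eigenfunction \<xi> (left_shift base_point) = \<xi>" if "\<xi> \<in> eigenvalues" for \<xi>
    using eigenfunction_shift[OF that base_point] eigenfunction_base_point[OF that] by simp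
  from this[OF assms(1)] this[OF assms(2)] show ?thesis
    unfolding assms(3) by (rule trans[OF sym])
qed

lemma norm_eigenvalue:
  assumes "\<zeta> \<in> eigenvalues"
  shows "norm \<zeta> = 1"
proof -
  obtain k where "\<zeta> ^ (L ^ k) = 1" using assms unfolding eigenvalues_def by blast
  then show ?thesis by (rule norm_root_of_unity) simp
qed

text \<open>On the diagonal the integrand is 1. Otherwise invariance multiplies the integral by
  \<open>\<zeta> * cnj \<zeta>'\<close>, which is not 1 for distinct numbers on the unit
  circle.\<close>

lemma eigenfunctions_orthonormal:
  assumes \<zeta>: "\<zeta> \<in> eigenvalues" and \<zeta>': "\<zeta>' \<in> eigenvalues"
  shows "(LINT x|M. eigenfunction \<zeta> x * cnj (eigenfunction \<zeta>' x)) = (if \<zeta> = \<zeta>' then 1 else 0)"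
proof (cases "\<zeta> = \<zeta>'")
  case True
  have "(LINT x|M. eigenfunction \<zeta> x * cnj (eigenfunction \<zeta> x)) = (LINT x|M. 1)"
  proof (rule Bochner_Integration.integral_cong)
    fix x assume "x \<in> space M"
    then have "cmod (eigenfunction \<zeta> x) = 1" using norm_eigenfunction[OF \<zeta>] by simp
    then show "eigenfunction \<zeta> x * cnj (eigenfunction \<zeta> x) = 1"
      by (simp add: complex_norm_square[symmetric])
  qed simp
  with True show ?thesis by (simp add: prob_space[unfolded space_M])
next
  case False
  define f where "f x = eigenfunction \<zeta> x * cnj (eigenfunction \<zeta>' x)" for x
  have [measurable]: "f \<in> borel_measurable M"
    unfolding f_def
    by (intro borel_measurable_times measurable_eigenfunction \<zeta> \<zeta>'
        borel_measurable_continuous_on[OF continuous_on_cnj[OF continuous_on_id]])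
  have "(LINT x|M. f x) = (LINT x|M. f (left_shift x))" by (rule integral_shift[symmetric]) measurable
  also have "\<dots> = (LINT x|M. (\<zeta> * cnj \<zeta>') * f x)"
    by (rule Bochner_Integration.integral_cong)
      (simp_all add: f_def eigenfunction_shift \<zeta> \<zeta>')
  finally have "(1 - \<zeta> * cnj \<zeta>') * (LINT x|M. f x) = 0" by (simp add: left_diff_distrib)
  moreover have "\<zeta> * cnj \<zeta>' \<noteq> 1"
  proof
    assume "\<zeta> * cnj \<zeta>' = 1"
    then have "\<zeta> * (cnj \<zeta>' * \<zeta>') = \<zeta>'" by (metis mult.assoc mult_1)
    moreover have "cnj \<zeta>' * \<zeta>' = 1"
      using norm_eigenvalue[OF \<zeta>'] complex_norm_square[of \<zeta>'] by (simp add: mult.commute)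
    ultimately show False using False by simp
  qed
  ultimately have "(LINT x|M. f x) = 0" by simp
  with False show ?thesis by (simp add: f_def)
qed

lemma spectral_component_eq:
  assumes \<zeta>: "\<zeta> ^ (L ^ k) = 1" and V: "cylinder W V" and x: "x \<in> X"
  shows "spectral_component \<zeta> V x =
    (if \<zeta> \<in> eigenvalues then spectral_component \<zeta> V base_point * eigenfunction \<zeta> x else 0)"
proof (cases "\<zeta> \<in> eigenvalues")
  case True
  obtain k' W' V' where *: "cylinder W' V'" "spectral_component \<zeta> V' base_point \<noteq> 0"
    "eigenfunction \<zeta> = (\<lambda>x. spectral_component \<zeta> V' x / spectral_component \<zeta> V' base_point)"
    by (rule eigenfunctionE[OF True])
  from spectral_component_proportional[OF \<zeta> V *(1) x base_point] True *(2,3)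
  show ?thesis by (simp add: field_simps)
next
  case False
  then have "spectral_component \<zeta> V base_point = 0" using \<zeta> V unfolding eigenvalues_def by blast
  with spectral_component_norm_eq[OF \<zeta> V x base_point] False show ?thesis by simp
qed

text \<open>Summation over the roots retains only times divisible by \<open>L ^ k\<close>, so the
  spectral sum becomes an average over returns to the same residue.\<close>

lemma sum_twisted_average:
  assumes "k \<le> K"
  shows "(\<Sum>\<zeta> | \<zeta> ^ (L ^ k) = 1. twisted_average \<zeta> K V x)
    = (\<Sum>j<L ^ (K - k). indicator V ((left_shift ^^ (j * L ^ k)) x)) / of_nat (L ^ (K - k))"
proof -
  let ?N = "L ^ k" and ?J = "L ^ (K - k)"
  let ?f = "\<lambda>i. indicator V ((left_shift ^^ i) x) :: complex"
  have K: "L ^ K = ?J * ?N" using assms by (simp flip: power_add)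
  have "(\<Sum>\<zeta> | \<zeta> ^ ?N = 1. twisted_average \<zeta> K V x)
      = (\<Sum>i<?J * ?N. (\<Sum>\<zeta> | \<zeta> ^ ?N = 1. cnj \<zeta> ^ i) * ?f i) / of_nat (?J * ?N)"
    unfolding twisted_average_def K sum_divide_distrib[symmetric] sum_distrib_right
    by (subst sum.swap) simp
  also have "(\<Sum>i<?J * ?N. (\<Sum>\<zeta> | \<zeta> ^ ?N = 1. cnj \<zeta> ^ i) * ?f i)
      = (\<Sum>i<?J * ?N. if ?N dvd i then of_nat ?N * ?f i else 0)"
    by (intro sum.cong refl) (simp add: sum_power_roots_of_unity del: of_nat_power)
  also have "\<dots> = (\<Sum>j<?J. of_nat ?N * ?f (j * ?N))"
    unfolding sum_blocks
  proof (intro sum.cong refl)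
    fix j
    have "(\<Sum>i<?N. if ?N dvd (i + j * ?N) then of_nat ?N * ?f (i + j * ?N) else 0)
        = (\<Sum>i<?N. if i = 0 then of_nat ?N * ?f (j * ?N) else 0)"
      by (intro sum.cong refl) (auto simp: dvd_add_left_iff dest: dvd_imp_le)
    then show "(\<Sum>i<?N. if ?N dvd (i + j * ?N) then of_nat ?N * ?f (i + j * ?N) else 0)
        = of_nat ?N * ?f (j * ?N)" by simp
  qed
  finally show ?thesis by (simp flip: sum_distrib_left)
qed

text \<open>Moving by a multiple of \<open>L ^ k\<close> keeps the residue, so the indicator can
  change only at an unresolved residue. Invariance spreads the integral over a full period, where
  such residues are counted.\<close>

lemma mean_deviation_from_return:
  assumes V: "cylinder W V"
  shows "(LINT x|M. cmod (indicator V x - indicator V ((left_shift ^^ (j * L ^ k)) x))) \<le> defect k W"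
proof -
  let ?N = "L ^ k"
  define d where "d x = indicator V x - (indicator V ((left_shift ^^ (j * ?N)) x) :: complex)" for x
  note [measurable] = measurable_indicator_cylinder[OF V]
  have meas: "(\<lambda>x. complex_of_real (cmod (d x))) \<in> borel_measurable M"
    unfolding d_def by measurable
  have int: "integrable M (\<lambda>x. complex_of_real (cmod (d ((left_shift ^^ i) x))))" for i
    by (rule integrable_bounded[OF measurable_compose[OF measurable_funpow_shift meas], of _ 1])
      (simp add: d_def indicator_def)
  then have int': "integrable M (\<lambda>x. cmod (d ((left_shift ^^ i) x)))" for i
    by (simp add: complex_of_real_integrable_eq)
  have "(LINT x|M. cmod (d ((left_shift ^^ i) x))) = (LINT x|M. cmod (d x))" for i
    using integral_funpow_shift[OF meas, of i] by simp
  then have "(LINT x|M. cmod (d x)) = (\<Sum>i<?N. LINT x|M. cmod (d ((left_shift ^^ i) x))) / real ?N"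
    by simp
  also have "\<dots> = (LINT x|M. (\<Sum>i<?N. cmod (d ((left_shift ^^ i) x))) / real ?N)"
    using int' by (simp add: Bochner_Integration.integral_sum)
  also have "\<dots> \<le> (LINT x|M. defect k W)"
  proof (rule integral_mono)
    fix x assume "x \<in> space M"
    then have "x \<in> X" by simp
    then obtain r where r: "resolves k r x" by (rule ex_resolves)
    have "cmod (d ((left_shift ^^ i) x)) \<le> indicator (unresolved k W) ((r + i) mod ?N)" for i
    proof (cases "(r + i) mod ?N \<in> unresolved k W")
      case False
      let ?y = "(left_shift ^^ i) x"
      have y: "resolves k (r + i) ?y" by (rule resolves_shift[OF r])
      have "(r + i + j * ?N) mod ?N = (r + i) mod ?N" by (rule mod_mult_self1)
      with resolves_cylinder[OF resolves_shift[OF y, of "j * ?N"] V] resolves_cylinder[OF y V] False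
      have "(left_shift ^^ (j * ?N)) ?y \<in> V \<longleftrightarrow> ?y \<in> V" by simp
      then show ?thesis by (simp add: d_def indicator_def)
    qed (simp add: d_def indicator_def)
    then have "(\<Sum>i<?N. cmod (d ((left_shift ^^ i) x)))
        \<le> (\<Sum>i<?N. indicator (unresolved k W) ((r + i) mod ?N))" by (intro sum_mono)
    also have "\<dots> = card (unresolved k W)" by (rule sum_unresolved_rotate)
    finally have "(\<Sum>i<?N. cmod (d ((left_shift ^^ i) x))) / real ?N \<le> card (unresolved k W) / real ?N"
      by (rule divide_right_mono) simp
    also have "\<dots> \<le> defect k W" using V by (intro card_unresolved) (simp add: cylinder_def)
    finally show "(\<Sum>i<?N. cmod (d ((left_shift ^^ i) x))) / real ?N \<le> defect k W" .
  qed (use int' in auto)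
  finally show ?thesis by (simp add: d_def prob_space[unfolded space_M])
qed

text \<open>The error is a mean of return deviations and has modulus at most one, so its square is
  bounded by its modulus. The resulting bound is uniform in \<open>K\<close>, ready for passing to
  the limit.\<close>

lemma mean_square_twisted_averages:
  assumes V: "cylinder W V" and kK: "k \<le> K"
  shows "(LINT x|M. (cmod (indicator V x - (\<Sum>\<zeta> | \<zeta> ^ (L ^ k) = 1. twisted_average \<zeta> K V x)))\<^sup>2)
    \<le> defect k W"
proof -
  let ?J = "L ^ (K - k)"
  define d where "d j x = indicator V x - (indicator V ((left_shift ^^ (j * L ^ k)) x) :: complex)" for j x
  note [measurable] = measurable_indicator_cylinder[OF V]
  have [measurable]: "d j \<in> borel_measurable M" for j unfolding d_def by measurable
  have d_le: "cmod (d j x) \<le> 1" for j x by (simp add: d_def indicator_def)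
  have int: "integrable M (\<lambda>x. cmod (d j x))" for j
    by (rule integrable_const_bound[of _ 1]) (auto simp: d_le)
  have eq: "indicator V x - (\<Sum>\<zeta> | \<zeta> ^ (L ^ k) = 1. twisted_average \<zeta> K V x)
      = (\<Sum>j<?J. d j x) / of_nat ?J" for x
    unfolding sum_twisted_average[OF kK] by (simp add: d_def sum_subtractf diff_divide_distrib)
  have le: "(cmod ((\<Sum>j<?J. d j x) / of_nat ?J))\<^sup>2 \<le> (\<Sum>j<?J. cmod (d j x)) / real ?J" for x
  proof -
    have lr: "cmod ((\<Sum>j<?J. d j x) / of_nat ?J) \<le> (\<Sum>j<?J. cmod (d j x)) / real ?J" (is "?l \<le> ?r")
      by (simp only: norm_divide norm_of_nat) (intro divide_right_mono norm_sum, simp)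
    also have "?r \<le> 1" using sum_bounded_above[of "{..<?J}" "\<lambda>j. cmod (d j x)" 1] d_le
      by (simp add: divide_le_eq)
    finally have "?l * ?l \<le> 1 * ?l" by (rule mult_right_mono) simp
    with lr show ?thesis unfolding power2_eq_square by linarith
  qed
  have "(LINT x|M. (cmod ((\<Sum>j<?J. d j x) / of_nat ?J))\<^sup>2) \<le> (LINT x|M. (\<Sum>j<?J. cmod (d j x)) / real ?J)"
  proof (rule integral_mono)
    show sum_int: "integrable M (\<lambda>x. (\<Sum>j<?J. cmod (d j x)) / real ?J)" using int by auto
    show "integrable M (\<lambda>x. (cmod ((\<Sum>j<?J. d j x) / of_nat ?J))\<^sup>2)"
    proof (rule Bochner_Integration.integrable_bound[OF sum_int _ AE_I2])
      fix x
      have "norm ((cmod ((\<Sum>j<?J. d j x) / of_nat ?J))\<^sup>2) = (cmod ((\<Sum>j<?J. d j x) / of_nat ?J))\<^sup>2"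
        by simp
      also have "\<dots> \<le> norm ((\<Sum>j<?J. cmod (d j x)) / real ?J)"
        unfolding real_norm_def by (rule order.trans[OF le abs_ge_self])
      finally show "norm ((cmod ((\<Sum>j<?J. d j x) / of_nat ?J))\<^sup>2)
          \<le> norm ((\<Sum>j<?J. cmod (d j x)) / real ?J)" .
    qed measurable
  qed (rule le)
  also have "\<dots> = (\<Sum>j<?J. LINT x|M. cmod (d j x)) / real ?J"
    using int by (simp add: Bochner_Integration.integral_sum)
  also have "\<dots> \<le> (\<Sum>j<?J. defect k W) / real ?J"
    using mean_deviation_from_return[OF V] by (intro divide_right_mono sum_mono) (auto simp: d_def)
  finally show ?thesis unfolding eq by simp
qed

text \<open>The limit in \<open>K\<close> is taken with \<open>k\<close> fixed: the set of roots
  stays finite and dominated convergence applies.\<close>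

lemma mean_square_spectral_components:
  assumes V: "cylinder W V"
  shows "(LINT x|M. (cmod (indicator V x - (\<Sum>\<zeta> | \<zeta> ^ (L ^ k) = 1. spectral_component \<zeta> V x)))\<^sup>2)
    \<le> defect k W"
proof -
  let ?R = "{\<zeta>::complex. \<zeta> ^ (L ^ k) = 1}"
  let ?g = "\<lambda>K x. (cmod (indicator V x - (\<Sum>\<zeta>\<in>?R. twisted_average \<zeta> K V x)))\<^sup>2"
  let ?h = "\<lambda>x. (cmod (indicator V x - (\<Sum>\<zeta>\<in>?R. spectral_component \<zeta> V x)))\<^sup>2"
  note [measurable] = measurable_indicator_cylinder[OF V] measurable_twisted_average[OF V]
  have "(\<lambda>x. \<Sum>\<zeta>\<in>?R. spectral_component \<zeta> V x) \<in> borel_measurable M"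
    by (intro borel_measurable_sum measurable_spectral_component[OF _ V]) auto
  then have meas_h: "?h \<in> borel_measurable M" by measurable
  have "(\<lambda>K. LINT x|M. ?g K x) \<longlonglongrightarrow> (LINT x|M. ?h x)"
  proof (rule integral_dominated_convergence[where w = "\<lambda>_. (1 + real (card ?R))\<^sup>2"])
    show "AE x in M. (\<lambda>K. ?g K x) \<longlonglongrightarrow> ?h x"
    proof (rule AE_I2)
      fix x assume "x \<in> space M"
      then show "(\<lambda>K. ?g K x) \<longlonglongrightarrow> ?h x"
        using twisted_average_tendsto[OF _ V] by (intro tendsto_intros) auto
    qed
    show "AE x in M. norm (?g K x) \<le> (1 + real (card ?R))\<^sup>2" for K
    proof (rule AE_I2)
      fix x
      have "norm \<zeta> = 1" if "\<zeta> \<in> ?R" for \<zeta>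
        using that norm_root_of_unity[of \<zeta> "L ^ k"] by simp
      then have "norm (\<Sum>\<zeta>\<in>?R. twisted_average \<zeta> K V x) \<le> (\<Sum>\<zeta>\<in>?R. 1)"
        by (intro order.trans[OF norm_sum] sum_mono twisted_average_bound) auto
      moreover have "norm (indicator V x :: complex) \<le> 1" by (simp add: indicator_def)
      ultimately have "cmod (indicator V x - (\<Sum>\<zeta>\<in>?R. twisted_average \<zeta> K V x)) \<le> 1 + real (card ?R)"
        by (intro order.trans[OF norm_triangle_ineq4]) simp
      then show "norm (?g K x) \<le> (1 + real (card ?R))\<^sup>2" by (simp add: power_mono)
    qed
  qed (use meas_h in measurable)
  moreover have "\<exists>K0. \<forall>K\<ge>K0. (LINT x|M. ?g K x) \<le> defect k W"
    using mean_square_twisted_averages[OF V] by blast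
  ultimately show ?thesis by (rule LIMSEQ_le_const2)
qed

lemma mean_square_span_cylinder:
  assumes V: "cylinder W V"
  shows "mean_square_span M (eigenfunction ` eigenvalues) (indicator V)"
  unfolding mean_square_span_def
proof (intro allI impI)
  fix \<epsilon> :: real assume "\<epsilon> > 0"
  from order_tendstoD(2)[OF defect_tendsto this] obtain k where k: "defect k W < \<epsilon>"
    unfolding eventually_sequentially by blast
  let ?R = "{\<zeta>::complex. \<zeta> ^ (L ^ k) = 1}"
  let ?F = "eigenfunction ` (?R \<inter> eigenvalues)"
  \<comment> \<open>Coefficients are indexed by functions; evaluating at the shifted base point
    recovers the eigenvalue from \<open>f\<close>.\<close>
  define c where "c f = spectral_component (f (left_shift base_point)) V base_point" for f
  have fin: "finite ?R" by (rule finite_roots_unity) (simp add: Suc_leI)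
  have inj: "inj_on eigenfunction (?R \<inter> eigenvalues)"
    by (rule inj_onI) (use eigenfunction_inject in blast)
  have "(\<Sum>\<zeta>\<in>?R. spectral_component \<zeta> V x) = (\<Sum>f\<in>?F. c f * f x)" if x: "x \<in> X" for x
  proof -
    have "(\<Sum>\<zeta>\<in>?R. spectral_component \<zeta> V x)
        = (\<Sum>\<zeta>\<in>?R. if \<zeta> \<in> eigenvalues then spectral_component \<zeta> V base_point * eigenfunction \<zeta> x else 0)"
      by (intro sum.cong refl spectral_component_eq[OF _ V x]) simp
    also have "\<dots> = (\<Sum>\<zeta>\<in>?R \<inter> eigenvalues. spectral_component \<zeta> V base_point * eigenfunction \<zeta> x)"
      by (rule sum.inter_restrict[OF fin, symmetric])
    also have "\<dots> = (\<Sum>\<zeta>\<in>?R \<inter> eigenvalues. c (eigenfunction \<zeta>) * eigenfunction \<zeta> x)"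
      by (intro sum.cong refl)
        (simp add: c_def eigenfunction_shift base_point eigenfunction_base_point)
    also have "\<dots> = (\<Sum>f\<in>?F. c f * f x)" by (simp add: sum.reindex[OF inj])
    finally show ?thesis .
  qed
  then have "(LINT x|M. (cmod (indicator V x - (\<Sum>f\<in>?F. c f * f x)))\<^sup>2)
      = (LINT x|M. (cmod (indicator V x - (\<Sum>\<zeta>\<in>?R. spectral_component \<zeta> V x)))\<^sup>2)"
    by (intro Bochner_Integration.integral_cong) auto
  also have "\<dots> < \<epsilon>" using mean_square_spectral_components[OF V, of k] k by linarith
  finally show "\<exists>F c. finite F \<and> F \<subseteq> eigenfunction ` eigenvalues \<and>
      (LINT x|M. (cmod (indicator V x - (\<Sum>f\<in>F. c f * f x)))\<^sup>2) < \<epsilon>"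
    using fin by (intro exI[of _ ?F] exI[of _ c]) auto
qed

section \<open>Approximation of measurable sets by cylinders\<close>

lemma inner_approx:
  assumes E: "E \<in> sets M" and \<epsilon>: "\<epsilon> > 0"
  obtains K where "compact K" "K \<subseteq> E" "K \<in> sets M" "measure M (E - K) < \<epsilon>"
proof -
  have sup: "emeasure M E = (SUP K\<in>{K. compact K \<and> K \<subseteq> E}. emeasure M K)"
    using regular_M E by (simp add: regular_borel_prob_def)
  have "\<exists>K. compact K \<and> K \<subseteq> E \<and> measure M E - \<epsilon> < measure M K"
  \<comment> \<open>When \<open>measure M E - \<epsilon>\<close> is negative its conversion to
    \<open>ennreal\<close> would be truncated to 0; the empty set serves as
    \<open>K\<close>.\<close>
  proof (cases "measure M E < \<epsilon>")
    case True
    then show ?thesis by (intro exI[of _ "{}"]) simp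
  next
    case False
    then have "ennreal (measure M E - \<epsilon>) < emeasure M E"
      using \<epsilon> by (simp add: emeasure_eq_measure ennreal_less_iff)
    then obtain K where "compact K" "K \<subseteq> E" "ennreal (measure M E - \<epsilon>) < emeasure M K"
      unfolding sup less_SUP_iff by blast
    with False show ?thesis by (auto simp: emeasure_eq_measure ennreal_less_iff)
  qed
  then obtain K where K: "compact K" "K \<subseteq> E" "measure M E - \<epsilon> < measure M K" by blast
  have KX: "K \<subseteq> X" using K(2) sets.sets_into_space[OF E] by auto
  then have K_sets: "K \<in> sets M"
    using K(1) by (auto simp: sets_M sets_restrict_space compact_imp_closed_fun intro!: image_eqI[of _ _ K])
  have "measure M (E - K) < \<epsilon>" using K(3) finite_measure_Diff[OF E K_sets K(2)] by simp
  with K K_sets show thesis using that by blast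
qed

text \<open>Compact sets exhaust \<open>E\<close> and its complement up to half of \<epsilon> each.
  A cylinder containing the one and missing the other differs from \<open>E\<close> only on the two
  small remainders.\<close>

lemma ex_cylinder_approx:
  assumes E: "E \<in> sets M" and \<epsilon>: "\<epsilon> > 0"
  obtains W V where "cylinder W V" "(LINT x|M. (cmod (indicator E x - indicator V x))\<^sup>2) < \<epsilon>"
proof -
  have half: "\<epsilon> / 2 > 0" using \<epsilon> by simp
  have E': "X - E \<in> sets M" using sets.compl_sets[OF E] by simp
  obtain K where K: "compact K" "K \<subseteq> E" "K \<in> sets M" "measure M (E - K) < \<epsilon> / 2"
    using inner_approx[OF E half] .
  obtain K' where K': "compact K'" "K' \<subseteq> X - E" "K' \<in> sets M" "measure M ((X - E) - K') < \<epsilon> / 2"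
    using inner_approx[OF E' half] .
  have "open (- K')" using compact_imp_closed_fun[OF K'(1)] by (simp add: open_Compl)
  moreover have "K \<subseteq> - K'" using K(2) K'(2) by auto
  ultimately obtain W V where V: "cylinder W V" "K \<subseteq> V" "V \<subseteq> - K'"
    by (rule compact_subset_cylinder[OF K(1)])
  let ?D = "(E - K) \<union> ((X - E) - K')"
  have D: "?D \<in> sets M" using E K(3) E' K'(3) by auto
  have "(LINT x|M. (cmod (indicator E x - indicator V x))\<^sup>2) \<le> (LINT x|M. indicator ?D x)"
  proof (rule integral_mono)
    have meas: "indicator E \<in> borel_measurable M" using E by simp
    show "integrable M (\<lambda>x. (cmod (indicator E x - indicator V x))\<^sup>2)"
    proof (rule integrable_const_bound[of _ 1])
      show "(\<lambda>x. (cmod (indicator E x - indicator V x))\<^sup>2) \<in> borel_measurable M"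
        using meas measurable_indicator_cylinder[OF V(1)] by measurable
    qed (auto simp: indicator_def)
    show "integrable M (indicator ?D :: _ \<Rightarrow> real)"
      using D by (intro integrable_const_bound[of _ 1]) (auto simp: indicator_def)
    fix x assume "x \<in> space M"
    then show "(cmod (indicator E x - indicator V x))\<^sup>2 \<le> indicator ?D x"
      using V K(2) by (auto simp: indicator_def)
  qed
  also have "\<dots> = measure M ?D" using sets.sets_into_space[OF D] by (simp add: Int_absorb2)
  also have "\<dots> \<le> measure M (E - K) + measure M ((X - E) - K')"
    using E K(3) E' K'(3) by (intro measure_Un_le) auto
  also have "\<dots> < \<epsilon>" using K(4) K'(4) by simp
  finally show thesis using that V(1) by blast
qed

lemma pure_point: "pure_point_spectrum M left_shift"
  unfolding pure_point_spectrum_def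
proof (intro exI conjI ballI)
  let ?B = "eigenfunction ` eigenvalues"
  have B: "square_integrable M f" if "f \<in> ?B" for f
    using that square_integrable_eigenfunction by blast
  show "orthonormal_basis M ?B"
    unfolding orthonormal_basis_def
  proof (intro conjI ballI allI impI)
    show "square_integrable M f" if "f \<in> ?B" for f using that by (rule B)
    show "(LINT x|M. f x * cnj (g x)) = (if f = g then 1 else 0)" if "f \<in> ?B" "g \<in> ?B" for f g
      using that eigenfunctions_orthonormal eigenfunction_inject by auto
    fix h :: "(int \<Rightarrow> 'a) \<Rightarrow> complex" and \<epsilon> :: real
    assume h: "square_integrable M h" and \<epsilon>: "\<epsilon> > 0"
    have "mean_square_span M ?B (indicator E)" if E: "E \<in> sets M" for E
    proof (rule mean_square_span_limit[OF B])
      show "square_integrable M (indicator E)"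
        by (rule square_integrable_bounded[of _ 1]) (use E in \<open>auto simp: indicator_def\<close>)
      fix \<delta> :: real assume \<delta>: "\<delta> > 0"
      obtain W V where V: "cylinder W V" "(LINT x|M. (cmod (indicator E x - indicator V x))\<^sup>2) < \<delta>"
        using ex_cylinder_approx[OF E \<delta>] .
      moreover have "square_integrable M (indicator V)"
        by (rule square_integrable_bounded[of _ 1])
          (use measurable_indicator_cylinder[OF V(1)] in \<open>auto simp: indicator_def\<close>)
      ultimately show "\<exists>g. square_integrable M g \<and> mean_square_span M ?B g \<and>
          (LINT x|M. (cmod (indicator E x - g x))\<^sup>2) < \<delta>"
        using mean_square_span_cylinder by blast
    qed
    from mean_square_span_total[OF B finite_measure_axioms this h]
    show "\<exists>F c. finite F \<and> F \<subseteq> ?B \<and> (LINT x|M. (cmod (h x - (\<Sum>f\<in>F. c f * f x)))\<^sup>2) < \<epsilon>"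
      using \<epsilon> unfolding mean_square_span_def by blast
  qed
  fix f assume "f \<in> ?B"
  then obtain \<zeta> where \<zeta>: "\<zeta> \<in> eigenvalues" "f = eigenfunction \<zeta>" by blast
  show "koopman_eigenfunction M left_shift f"
    unfolding koopman_eigenfunction_def
  proof (intro conjI exI)
    show "square_integrable M f" using \<zeta> square_integrable_eigenfunction by simp
    show "AE x in M. f (left_shift x) = \<zeta> * f x"
      using \<zeta> by (auto intro!: AE_I2 eigenfunction_shift)
    show "\<not> (AE x in M. f x = 0)"
    proof
      assume "AE x in M. f x = 0"
      moreover have "f x \<noteq> 0" if "x \<in> X" for x using norm_eigenfunction[OF \<zeta>(1) that] \<zeta>(2) by auto
      then have "AE x in M. f x \<noteq> 0" by (auto intro!: AE_I2)
      ultimately have "AE x in M. False" by eventually_elim simp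
      then show False by (simp add: AE_False)
    qed
  qed
qed

end

theorem corollary4p13:
  fixes \<rho> :: "'a::{topological_ab_group_add, t2_space} \<Rightarrow> 'a list"
    and L :: nat
  assumes "compact (UNIV :: 'a set)"
    and "substitution \<rho>"
    and "constant_length \<rho> L"
    and "\<forall>j<L. group_translation (subst_column \<rho> j) \<or> constant_map (subst_column \<rho> j)"
    and "\<exists>j<L. constant_map (subst_column \<rho> j)"
    and "\<exists>j<L. group_translation (subst_column \<rho> j) \<and> has_dense_orbit (subst_column \<rho> j)"
  shows "primitive \<rho> \<and>
         strictly_ergodic (subshift \<rho>) left_shift \<and>
         pure_point_spectrum
           (THE \<mu>. invariant_prob (subshift \<rho>) left_shift \<mu>) left_shift"
proof -
  have "2 \<le> L" using assms(2,3) by (auto simp: substitution_def constant_length_def)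
  interpret column_substitution \<rho> L
    by unfold_locales (use assms \<open>2 \<le> L\<close> in auto)
  interpret invariant_measure \<rho> L subshift_measure
    by unfold_locales (rule invariant_subshift_measure)
  show ?thesis
    unfolding strictly_ergodic_def the_invariant_measure
    using primitive_substitution minimal_subshift[OF subshift_nonempty] uniquely_ergodic_subshift
      pure_point by blast
qed

end
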